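(* Let $\Omega=\prod_{i=1}^d (a_i,b_i)\subset\mathbb{R}^d$ be a $d$-dimensional hyperrectangle with side lengths $L_i=b_i-a_i>0$, and let $\mathcal{T}_h$ be a finite face-to-face partition of $\Omega$ into closed $d$-dimensional hyperrectangles (elements). Let $\kappa\in L^\infty(\Omega)$ with $\kappa\ge 0$, let $f\in L^2(\Omega)$, and let $u\in H^1_0(\Omega)$ be the weak solution of $-\Delta u+\kappa^2u=f$ in $\Omega$, $u=0$ on $\partial\Omega$, i.e. $$(\nabla u,\nabla v)+(\kappa^2u,v)=(f,v)\qquad\forall v\in H^1_0(\Omega).$$ Let $u_h\in H^1_0(\Omega)$, $\boldsymbol{\tau}\in \boldsymbol{H}(\operatorname{div},\Omega)$ and a constant $\kappa_0>0$ be arbitrary. Put $r=f-\kappa^2u_h$ and $\widetilde\kappa=\kappa+\kappa_0$. Then $$|\!|\!|u-u_h|\!|\!|\;\le\;\eta(\boldsymbol{\tau})+\kappa_0 C_{\mathrm P}\Bigl(\sum_{K\in\mathcal{T}_h}\bigl\|\widetilde\kappa^{-1}(\Pi_K r+\operatorname{div}\boldsymbol{\tau})\bigr\|_K^2\Bigr)^{1/2},$$ where $$C_{\mathrm P}=\pi^{-1}\Bigl(\sum_{i=1}^d L_i^{-2}\Bigr)^{-1/2}.$$ Moreover, if $0<\operatorname{ess\,inf}_\Omega\kappa$, then the same estimate holds with $\kappa_0=0$ (so that $\widetilde\kappa=\kappa$ and the second term on the right-hand side vanishes). Here the energy norm $|\!|\!|\cdot|\!|\!|$, the estimator $\eta(\boldsymbol{\tau})$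 and the projectors $\Pi_K$ are as defined in the context.
   Context: All functions are real-valued. $(\cdot,\cdot)$ denotes the inner product of $L^2(\Omega)$ or $[L^2(\Omega)]^d$; $\|\cdot\|$ and $\|\cdot\|_K$ denote the norms of $L^2(\Omega)$ and $L^2(K)$ (for scalar as well as vector-valued functions). $\boldsymbol{H}(\operatorname{div},\Omega)$ is the space of vector fields in $[L^2(\Omega)]^d$ whose distributional divergence lies in $L^2(\Omega)$. Energy norm: $|\!|\!|v|\!|\!|^2=\|\nabla v\|^2+\|\kappa v\|^2$ for $v\in H^1_0(\Omega)$. For $K\in\mathcal{T}_h$, $h_K$ is the diameter of $K$, and $\Pi_K:L^2(K)\to\mathbb{Q}_{1,1,\dots,1}(K)$ is the $L^2(K)$-orthogonal projector onto the space $\mathbb{Q}_{1,1,\dots,1}(K)$ of polynomials on $K$ of degree at most $1$ in each of the $d$ variables separately. For $g\in L^2(\Omega)$, $\Pi_K g$ means $\Pi_K(g|_K)$. With $r=f-\kappa^2u_h$ and $\widetilde\kappa=\kappa+\kappa_0$, define $$\eta^2(\boldsymbol{\tau})=\sum_{K\in\mathcal{T}_h}\bigl(\eta_K(\boldsymbol{\tau})+\operatorname{osc}_K(r)\bigr)^2,$$ $$\eta_K^2(\boldsymbol{\tau})=\|\boldsymbol{\tau}-\nabla u_h\|_K^2+\|\widetilde\kappa^{-1}(\Pi_Kr+\operatorname{div}\boldsymbol{\tau})\|_K^2,$$ $$\operatorname{osc}_K(r)=\min\bigl\{h_K\pi^{-1}\|r-\Pi_Kr\|_K,\ \|\kappa^{-1}(r-\Pi_Kr)\|_K\bigr\},$$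 where $\eta(\boldsymbol{\tau})$, $\eta_K(\boldsymbol{\tau})$ are the nonnegative square roots. Convention: if $\|\kappa^{-1}(r-\Pi_Kr)\|_K$ is not defined (that is, if $\kappa=0$ on a subset of $K$ of positive measure, or $\kappa^{-1}(r-\Pi_Kr)\notin L^2(K)$), this norm is taken to be $+\infty$, so that $\operatorname{osc}_K(r)=h_K\pi^{-1}\|r-\Pi_Kr\|_K$. *)

theory Defs
  imports "HOL-Analysis.Analysis" "HOL-Probability.Essential_Supremum"
begin

text \<open>
  The ambient space is a Euclidean space of dimension \<open>d = DIM('a)\<close> with its standard basis
  \<open>Basis\<close>, so coordinates are \<open>x \<bullet> i\<close> with \<open>i \<in> Basis\<close>.  Elements of Lebesgue and Sobolev
  spaces are represented by functions on the whole space, of which only the values almost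
  everywhere on the domain matter.
\<close>

definition L2_space :: "'a::euclidean_space set \<Rightarrow> ('a \<Rightarrow> 'b::euclidean_space) set" where
  "L2_space S = {f \<in> borel_measurable (lebesgue_on S).
                   integrable (lebesgue_on S) (\<lambda>x. (norm (f x))\<^sup>2)}"

definition L2_inner :: "'a::euclidean_space set \<Rightarrow> ('a \<Rightarrow> 'b::euclidean_space) \<Rightarrow> ('a \<Rightarrow> 'b) \<Rightarrow> real" where
  "L2_inner S f g = (LINT x|lebesgue_on S. f x \<bullet> g x)"

definition L2_norm :: "'a::euclidean_space set \<Rightarrow> ('a \<Rightarrow> 'b::euclidean_space) \<Rightarrow> real" where
  "L2_norm S f = sqrt (L2_inner S f f)"

definition Linf_space :: "'a::euclidean_space set \<Rightarrow> ('a \<Rightarrow> real) set" where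
  "Linf_space S = {f \<in> borel_measurable (lebesgue_on S).
                     esssup (lebesgue_on S) (\<lambda>x. ereal \<bar>f x\<bar>) < \<infinity>}"

definition ess_inf :: "'a::euclidean_space set \<Rightarrow> ('a \<Rightarrow> real) \<Rightarrow> ereal" where
  "ess_inf S f = - esssup (lebesgue_on S) (\<lambda>x. - ereal (f x))"

definition partial_deriv :: "'a::euclidean_space \<Rightarrow> ('a \<Rightarrow> real) \<Rightarrow> 'a \<Rightarrow> real" where
  "partial_deriv i \<phi> x = frechet_derivative \<phi> (at x) i"

definition grad :: "('a::euclidean_space \<Rightarrow> real) \<Rightarrow> 'a \<Rightarrow> 'a" where
  "grad \<phi> x = (\<Sum>i\<in>Basis. partial_deriv i \<phi> x *\<^sub>R i)"

primrec Ck :: "nat \<Rightarrow> ('a::euclidean_space \<Rightarrow> real) \<Rightarrow> bool" where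
  "Ck 0 \<phi> \<longleftrightarrow> continuous_on UNIV \<phi>"
| "Ck (Suc k) \<phi> \<longleftrightarrow> (\<forall>x. \<phi> differentiable at x) \<and> (\<forall>i\<in>Basis. Ck k (partial_deriv i \<phi>))"

definition test_functions :: "'a::euclidean_space set \<Rightarrow> ('a \<Rightarrow> real) set" where
  "test_functions \<Omega> = {\<phi>. (\<forall>k. Ck k \<phi>) \<and> compact (closure {x. \<phi> x \<noteq> 0})
                          \<and> closure {x. \<phi> x \<noteq> 0} \<subseteq> \<Omega>}"

definition has_weak_gradient :: "'a::euclidean_space set \<Rightarrow> ('a \<Rightarrow> real) \<Rightarrow> ('a \<Rightarrow> 'a) \<Rightarrow> bool" where
  "has_weak_gradient \<Omega> v g \<longleftrightarrow> g \<in> L2_space \<Omega> \<and>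
     (\<forall>\<phi>\<in>test_functions \<Omega>. \<forall>i\<in>Basis.
        L2_inner \<Omega> v (partial_deriv i \<phi>) = - L2_inner \<Omega> (\<lambda>x. g x \<bullet> i) \<phi>)"

text \<open>Weak gradients and divergences are unique only up to null sets; some representative is
  chosen.\<close>

definition weak_grad :: "'a::euclidean_space set \<Rightarrow> ('a \<Rightarrow> real) \<Rightarrow> 'a \<Rightarrow> 'a" where
  "weak_grad \<Omega> v = (SOME g. has_weak_gradient \<Omega> v g)"

definition has_weak_divergence :: "'a::euclidean_space set \<Rightarrow> ('a \<Rightarrow> 'a) \<Rightarrow> ('a \<Rightarrow> real) \<Rightarrow> bool" where
  "has_weak_divergence \<Omega> \<tau> q \<longleftrightarrow> q \<in> L2_space \<Omega> \<and>
     (\<forall>\<phi>\<in>test_functions \<Omega>. L2_inner \<Omega> \<tau> (grad \<phi>) = - L2_inner \<Omega> q \<phi>)"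

definition weak_div :: "'a::euclidean_space set \<Rightarrow> ('a \<Rightarrow> 'a) \<Rightarrow> 'a \<Rightarrow> real" where
  "weak_div \<Omega> \<tau> = (SOME q. has_weak_divergence \<Omega> \<tau> q)"

definition H1_space :: "'a::euclidean_space set \<Rightarrow> ('a \<Rightarrow> real) set" where
  "H1_space \<Omega> = {v \<in> L2_space \<Omega>. \<exists>g. has_weak_gradient \<Omega> v g}"

text \<open>The closure of the test functions in the \<open>H\<^sup>1\<close> norm.\<close>

definition H10_space :: "'a::euclidean_space set \<Rightarrow> ('a \<Rightarrow> real) set" where
  "H10_space \<Omega> = {v \<in> H1_space \<Omega>. \<exists>\<phi>. (\<forall>n::nat. \<phi> n \<in> test_functions \<Omega>) \<and>
     (\<lambda>n. L2_norm \<Omega> (\<lambda>x. v x - \<phi> n x)) \<longlonglongrightarrow> 0 \<and>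
     (\<lambda>n. L2_norm \<Omega> (\<lambda>x. weak_grad \<Omega> v x - grad (\<phi> n) x)) \<longlonglongrightarrow> 0}"

definition Hdiv_space :: "'a::euclidean_space set \<Rightarrow> ('a \<Rightarrow> 'a) set" where
  "Hdiv_space \<Omega> = {\<tau> \<in> L2_space \<Omega>. \<exists>q. has_weak_divergence \<Omega> \<tau> q}"

definition weak_solution ::
  "'a::euclidean_space set \<Rightarrow> ('a \<Rightarrow> real) \<Rightarrow> ('a \<Rightarrow> real) \<Rightarrow> ('a \<Rightarrow> real) \<Rightarrow> bool" where
  "weak_solution \<Omega> \<kappa> f u \<longleftrightarrow> u \<in> H10_space \<Omega> \<and>
     (\<forall>v\<in>H10_space \<Omega>. L2_inner \<Omega> (weak_grad \<Omega> u) (weak_grad \<Omega> v)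
          + L2_inner \<Omega> (\<lambda>x. (\<kappa> x)\<^sup>2 * u x) v = L2_inner \<Omega> f v)"

definition energy_norm :: "'a::euclidean_space set \<Rightarrow> ('a \<Rightarrow> real) \<Rightarrow> ('a \<Rightarrow> real) \<Rightarrow> real" where
  "energy_norm \<Omega> \<kappa> v =
     sqrt ((L2_norm \<Omega> (weak_grad \<Omega> v))\<^sup>2 + (L2_norm \<Omega> (\<lambda>x. \<kappa> x * v x))\<^sup>2)"

text \<open>\<open>division_of\<close> already provides finiteness, closed boxes as elements and disjoint
  interiors, but admits degenerate boxes.  Note that the empty set is a face.\<close>

definition hyperrectangular_mesh :: "'a::euclidean_space set set \<Rightarrow> 'a set \<Rightarrow> bool" where
  "hyperrectangular_mesh T \<Omega> \<longleftrightarrow> T division_of (closure \<Omega>) \<and> (\<forall>K\<in>T. interior K \<noteq> {}) \<and>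
     (\<forall>K\<in>T. \<forall>K'\<in>T. (K \<inter> K') face_of K \<and> (K \<inter> K') face_of K')"

text \<open>Polynomials of degree at most 1 in each variable separately.\<close>

definition Q1 :: "('a::euclidean_space \<Rightarrow> real) set" where
  "Q1 = {p. \<exists>c. p = (\<lambda>x. \<Sum>S\<in>Pow Basis. c S * (\<Prod>i\<in>S. x \<bullet> i))}"

text \<open>The projection is unique when \<open>K\<close> has nonempty interior.\<close>

definition proj_Q1 :: "'a::euclidean_space set \<Rightarrow> ('a \<Rightarrow> real) \<Rightarrow> 'a \<Rightarrow> real" where
  "proj_Q1 K g = (SOME p. p \<in> Q1 \<and> (\<forall>q\<in>Q1. L2_inner K (\<lambda>x. g x - p x) q = 0))"

definition residual :: "('a \<Rightarrow> real) \<Rightarrow> ('a \<Rightarrow> real) \<Rightarrow> ('a \<Rightarrow> real) \<Rightarrow> 'a \<Rightarrow> real" where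
  "residual \<kappa> f uh x = f x - (\<kappa> x)\<^sup>2 * uh x"

definition div_residual_norm ::
  "'a::euclidean_space set \<Rightarrow> ('a \<Rightarrow> real) \<Rightarrow> real \<Rightarrow> ('a \<Rightarrow> real) \<Rightarrow> ('a \<Rightarrow> 'a) \<Rightarrow> 'a set \<Rightarrow> real" where
  "div_residual_norm \<Omega> \<kappa> \<kappa>\<^sub>0 r \<tau> K =
     L2_norm K (\<lambda>x. inverse (\<kappa> x + \<kappa>\<^sub>0) * (proj_Q1 K r x + weak_div \<Omega> \<tau> x))"

definition eta_elem ::
  "'a::euclidean_space set \<Rightarrow> ('a \<Rightarrow> real) \<Rightarrow> real \<Rightarrow> ('a \<Rightarrow> real) \<Rightarrow> ('a \<Rightarrow> real) \<Rightarrow> ('a \<Rightarrow> 'a) \<Rightarrow> 'a set \<Rightarrow> real" where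
  "eta_elem \<Omega> \<kappa> \<kappa>\<^sub>0 f uh \<tau> K =
     sqrt ((L2_norm K (\<lambda>x. \<tau> x - weak_grad \<Omega> uh x))\<^sup>2
           + (div_residual_norm \<Omega> \<kappa> \<kappa>\<^sub>0 (residual \<kappa> f uh) \<tau> K)\<^sup>2)"

text \<open>The \<open>\<kappa>\<close>-weighted norm counts as infinite when it is undefined; the condition \<open>\<kappa> \<noteq> 0\<close>
  a.e. has to be explicit because \<open>inverse 0 = 0\<close>.\<close>

definition osc :: "('a::euclidean_space \<Rightarrow> real) \<Rightarrow> ('a \<Rightarrow> real) \<Rightarrow> 'a set \<Rightarrow> real" where
  "osc \<kappa> r K =
     (let s = (\<lambda>x. r x - proj_Q1 K r x); w = (\<lambda>x. inverse (\<kappa> x) * s x);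
          m = diameter K / pi * L2_norm K s
      in if (AE x in lebesgue_on K. \<kappa> x \<noteq> 0) \<and> w \<in> L2_space K
         then min m (L2_norm K w) else m)"

definition eta ::
  "'a::euclidean_space set \<Rightarrow> 'a set set \<Rightarrow> ('a \<Rightarrow> real) \<Rightarrow> real \<Rightarrow> ('a \<Rightarrow> real) \<Rightarrow> ('a \<Rightarrow> real) \<Rightarrow> ('a \<Rightarrow> 'a) \<Rightarrow> real" where
  "eta \<Omega> T \<kappa> \<kappa>\<^sub>0 f uh \<tau> =
     sqrt (\<Sum>K\<in>T. (eta_elem \<Omega> \<kappa> \<kappa>\<^sub>0 f uh \<tau> K + osc \<kappa> (residual \<kappa> f uh) K)\<^sup>2)"

definition C_P :: "'a::euclidean_space \<Rightarrow> 'a \<Rightarrow> real" where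
  "C_P a b = inverse pi * (\<Sum>i\<in>Basis. inverse ((b \<bullet> i - a \<bullet> i)\<^sup>2)) powr (- 1 / 2)"

end

theory Submission
  imports Defs "HOL-Computational_Algebra.Polynomial" "HOL-Real_Asymp.Real_Asymp"
begin

text \<open>
  Testing the weak formulation with \<open>e = u - u\<^sub>h\<close> and using Green's formula for \<open>\<tau>\<close> turns the squared
  energy norm of the error into \<open>\<Sum>K. (\<tau> - \<nabla>u\<^sub>h, \<nabla>e)\<^sub>K + (\<Pi>\<^sub>K r + div \<tau>, e)\<^sub>K + (r - \<Pi>\<^sub>K r, e)\<^sub>K\<close>.  In the
  second term one splits \<open>(\<kappa> + \<kappa>\<^sub>0) e\<close>; the \<open>\<kappa>\<^sub>0\<close> part is controlled by the Friedrichs inequality on the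
  box.  In the third one \<open>e\<close> may be replaced by \<open>e\<close> minus a constant, which brings in the Poincare
  inequality with constant \<open>h\<^sub>K / \<pi>\<close>.

  Both inequalities are reduced to lines parallel to the axes.  On an interval the Dirichlet
  inequality with the sharp constant follows from \<open>0 \<le> \<integral> (F' + l tan (l (t - m)) F)\<^sup>2\<close>, and the
  Neumann inequality from the Dirichlet one applied to a primitive.
\<close>

section \<open>Sharp Poincare inequalities on an interval\<close>

text \<open>For general convex elements the constant (diameter over \<pi>) is the Payne-Weinberger
  theorem. Boxes admit an elementary route: averaging over one coordinate after another costs side
  length over \<pi> times the norm of the corresponding partial derivative, and Cauchy-Schwarz turns
  the sum of these costs into the diameter times the norm of the gradient. In the Friedrichs
  inequality the squared directional estimates are added instead: \<pi> squared times the sum of the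
  inverse squared side lengths is the smallest Dirichlet eigenvalue of the negative Laplacian on the
  box, and \<open>C_P\<close> is its inverse square root.

  Both inequalities are shown for continuously differentiable functions and carried over to
  \<open>H10_space\<close> by density. An obstacle is that \<open>weak_grad\<close> is an arbitrary
  choice of representative: the gradient of a difference and the difference of the gradients agree
  only almost everywhere. This is why uniqueness of weak gradients, and with it a supply of explicit
  test functions, has to be established.

  The two cases of the theorem share one argument, built on a positive lower bound of
  \<open>\<kappa> + \<kappa>\<^sub>0\<close> almost everywhere.\<close>

lemma dirichlet_poincare_1d_strict:
  fixes F F' :: "real \<Rightarrow> real"
  assumes ab: "\<alpha> < \<beta>"
    and F: "\<And>t. t \<in> {\<alpha>..\<beta>} \<Longrightarrow> (F has_field_derivative F' t) (at t within {\<alpha>..\<beta>})"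
    and F': "continuous_on {\<alpha>..\<beta>} F'"
    and bc: "F \<alpha> = 0" "F \<beta> = 0"
    and l: "0 < l" "l * (\<beta> - \<alpha>) < pi"
  shows "l\<^sup>2 * integral {\<alpha>..\<beta>} (\<lambda>t. (F t)\<^sup>2) \<le> integral {\<alpha>..\<beta>} (\<lambda>t. (F' t)\<^sup>2)"
proof -
  \<comment> \<open>\<open>c\<close> is the logarithmic derivative of cos (l (t - m)), a solution of
    y'' = - l^2 y, and therefore satisfies the Riccati equation c' = - l^2 - c^2. Centring at the
    midpoint together with the strict bound \<open>l * (\<beta> - \<alpha>) < pi\<close> keeps the
    cosine away from its zeros on the whole closed interval.\<close>
  define m where "m = (\<alpha> + \<beta>) / 2"
  define c where "c t = - l * tan (l * (t - m))" for t
  have cos0: "cos (l * (t - m)) \<noteq> 0" if "t \<in> {\<alpha>..\<beta>}" for t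
  proof -
    have "l * (t - m) \<le> l * ((\<beta> - \<alpha>) / 2)" "l * (- ((\<beta> - \<alpha>) / 2)) \<le> l * (t - m)"
      using that l by (intro mult_left_mono; simp add: m_def field_simps)+
    then have "- (pi/2) < l * (t - m)" "l * (t - m) < pi / 2"
      using l by (simp_all add: field_simps)
    then show ?thesis using cos_gt_zero_pi by force
  qed
  have c': "(c has_field_derivative - l\<^sup>2 - (c t)\<^sup>2) (at t within {\<alpha>..\<beta>})"
    if "t \<in> {\<alpha>..\<beta>}" for t
    unfolding c_def using cos0[OF that]
    by (auto intro!: derivative_eq_intros simp: tan_def field_simps power2_eq_square)
  have Fc: "continuous_on {\<alpha>..\<beta>} F"
    by (rule DERIV_continuous_on[OF F])
  have cc: "continuous_on {\<alpha>..\<beta>} c"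
    by (rule DERIV_continuous_on[OF c'])
  let ?W = "\<lambda>t. (F t)\<^sup>2 * c t"
  \<comment> \<open>By the Riccati equation the integrand is an exact derivative. Its boundary
    values vanish with \<open>F\<close>, so the claim is what remains when the integral of the
    square is dropped.\<close>
  have W: "((\<lambda>t. (F' t)\<^sup>2 - l\<^sup>2 * (F t)\<^sup>2 - (F' t - c t * F t)\<^sup>2) has_integral ?W \<beta> - ?W \<alpha>) {\<alpha>..\<beta>}"
  proof (rule fundamental_theorem_of_calculus)
    fix t assume t: "t \<in> {\<alpha>..\<beta>}"
    have "(?W has_field_derivative (F' t)\<^sup>2 - l\<^sup>2 * (F t)\<^sup>2 - (F' t - c t * F t)\<^sup>2) (at t within {\<alpha>..\<beta>})"
      by (auto intro!: derivative_eq_intros F[OF t] c'[OF t] simp: power2_eq_square algebra_simps)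
    then show "(?W has_vector_derivative (F' t)\<^sup>2 - l\<^sup>2 * (F t)\<^sup>2 - (F' t - c t * F t)\<^sup>2) (at t within {\<alpha>..\<beta>})"
      by (simp add: has_real_derivative_iff_has_vector_derivative)
  qed (use ab in simp)
  have i1: "(\<lambda>t. (F' t)\<^sup>2) integrable_on {\<alpha>..\<beta>}"
    by (intro integrable_continuous_real continuous_intros F')
  have i2: "(\<lambda>t. l\<^sup>2 * (F t)\<^sup>2) integrable_on {\<alpha>..\<beta>}"
    by (intro integrable_continuous_real continuous_intros Fc)
  have i3: "(\<lambda>t. (F' t - c t * F t)\<^sup>2) integrable_on {\<alpha>..\<beta>}"
    by (intro integrable_continuous_real continuous_intros F' cc Fc)
  have "0 = integral {\<alpha>..\<beta>} (\<lambda>t. (F' t)\<^sup>2 - l\<^sup>2 * (F t)\<^sup>2 - (F' t - c t * F t)\<^sup>2)"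
    using integral_unique[OF W] bc by simp
  also have "\<dots> = integral {\<alpha>..\<beta>} (\<lambda>t. (F' t)\<^sup>2) - l\<^sup>2 * integral {\<alpha>..\<beta>} (\<lambda>t. (F t)\<^sup>2)
      - integral {\<alpha>..\<beta>} (\<lambda>t. (F' t - c t * F t)\<^sup>2)"
    using i1 i2 i3 by (simp add: integral_diff integrable_diff)
  finally show ?thesis
    using integral_nonneg[OF i3] by simp
qed

text \<open>At the sharp value of \<open>l\<close> the tangent blows up at both ends, so that value
  is reached only as a limit: \<open>l\<close> is chosen such that its square is \<open>z\<close>
  times the sharp constant, for arbitrary \<open>z < 1\<close>.\<close>

lemma dirichlet_poincare_1d:
  fixes F F' :: "real \<Rightarrow> real"
  assumes ab: "\<alpha> < \<beta>"
    and F: "\<And>t. t \<in> {\<alpha>..\<beta>} \<Longrightarrow> (F has_field_derivative F' t) (at t within {\<alpha>..\<beta>})"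
    and F': "continuous_on {\<alpha>..\<beta>} F'"
    and bc: "F \<alpha> = 0" "F \<beta> = 0"
  shows "(pi / (\<beta> - \<alpha>))\<^sup>2 * integral {\<alpha>..\<beta>} (\<lambda>t. (F t)\<^sup>2) \<le> integral {\<alpha>..\<beta>} (\<lambda>t. (F' t)\<^sup>2)"
proof (rule field_le_mult_one_interval)
  fix z :: real assume z: "0 < z" "z < 1"
  define l where "l = sqrt z * (pi / (\<beta> - \<alpha>))"
  have "0 < l" using z ab by (simp add: l_def)
  moreover have "l * (\<beta> - \<alpha>) < pi" using z ab by (simp add: l_def)
  ultimately have l: "0 < l" "l * (\<beta> - \<alpha>) < pi" by blast+
  from dirichlet_poincare_1d_strict[OF ab F F' bc l]
  show "z * ((pi / (\<beta> - \<alpha>))\<^sup>2 * integral {\<alpha>..\<beta>} (\<lambda>t. (F t)\<^sup>2)) \<le> integral {\<alpha>..\<beta>} (\<lambda>t. (F' t)\<^sup>2)"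
    using z by (simp add: l_def power_mult_distrib power_divide mult.assoc)
qed

text \<open>Dual to the Dirichlet case: the primitive of the mean-free part of \<open>f\<close> vanishes at both ends.\<close>

lemma neumann_poincare_1d:
  fixes f f' :: "real \<Rightarrow> real"
  assumes ab: "\<alpha> < \<beta>"
    and f: "\<And>t. t \<in> {\<alpha>..\<beta>} \<Longrightarrow> (f has_field_derivative f' t) (at t within {\<alpha>..\<beta>})"
    and f': "continuous_on {\<alpha>..\<beta>} f'"
  shows "integral {\<alpha>..\<beta>} (\<lambda>t. (f t - integral {\<alpha>..\<beta>} f / (\<beta> - \<alpha>))\<^sup>2)
    \<le> ((\<beta> - \<alpha>) / pi)\<^sup>2 * integral {\<alpha>..\<beta>} (\<lambda>t. (f' t)\<^sup>2)"
proof -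
  define L where "L = \<beta> - \<alpha>"
  define f0 where "f0 t = f t - integral {\<alpha>..\<beta>} f / L" for t
  define F where "F t = integral {\<alpha>..t} f0" for t
  have L: "L > 0" using ab by (simp add: L_def)
  have f0': "(f0 has_field_derivative f' t) (at t within {\<alpha>..\<beta>})" if "t \<in> {\<alpha>..\<beta>}" for t
    unfolding f0_def using f[OF that] by (auto intro!: derivative_eq_intros)
  have fc: "continuous_on {\<alpha>..\<beta>} f"
    by (rule DERIV_continuous_on[OF f])
  have f0c: "continuous_on {\<alpha>..\<beta>} f0" unfolding f0_def by (intro continuous_intros fc)
  have F': "(F has_field_derivative f0 t) (at t within {\<alpha>..\<beta>})" if "t \<in> {\<alpha>..\<beta>}" for t
    unfolding F_def has_real_derivative_iff_has_vector_derivative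
    by (rule integral_has_vector_derivative[OF f0c that])
  have Fc: "continuous_on {\<alpha>..\<beta>} F"
    by (rule DERIV_continuous_on[OF F'])
  have Fa: "F \<alpha> = 0" by (simp add: F_def)
  have Fb: "F \<beta> = 0"
    unfolding F_def f0_def using L ab
    by (subst integral_diff[OF integrable_continuous_real[OF fc]]) (auto simp: L_def)
  have D: "(pi / L)\<^sup>2 * integral {\<alpha>..\<beta>} (\<lambda>t. (F t)\<^sup>2) \<le> integral {\<alpha>..\<beta>} (\<lambda>t. (f0 t)\<^sup>2)"
    unfolding L_def by (rule dirichlet_poincare_1d[OF ab F' f0c Fa Fb])
  have "((\<lambda>t. (f0 t)\<^sup>2 + F t * f' t) has_integral F \<beta> * f0 \<beta> - F \<alpha> * f0 \<alpha>) {\<alpha>..\<beta>}"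
  proof (rule fundamental_theorem_of_calculus)
    fix t assume t: "t \<in> {\<alpha>..\<beta>}"
    have "((\<lambda>t. F t * f0 t) has_field_derivative (f0 t)\<^sup>2 + F t * f' t) (at t within {\<alpha>..\<beta>})"
      by (auto intro!: derivative_eq_intros F'[OF t] f0'[OF t] simp: power2_eq_square algebra_simps)
    then show "((\<lambda>t. F t * f0 t) has_vector_derivative (f0 t)\<^sup>2 + F t * f' t) (at t within {\<alpha>..\<beta>})"
      by (simp add: has_real_derivative_iff_has_vector_derivative)
  qed (use ab in simp)
  \<comment> \<open>Integration by parts without boundary terms: the integral of the square of
    \<open>f0\<close> is minus the integral of \<open>F * f'\<close>.\<close>
  then have ibp: "integral {\<alpha>..\<beta>} (\<lambda>t. (f0 t)\<^sup>2 + F t * f' t) = 0"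
    by (simp add: integral_unique Fa Fb)
  \<comment> \<open>\<open>s\<close> is the Dirichlet constant. Young's inequality with weight
    \<open>s\<close> makes the term in \<open>F\<close> at most half of the integral of the square
    of \<open>f0\<close>, which is absorbed into the left-hand side and leaves exactly the factor
    \<open>1 / s\<close>.\<close>
  define s where "s = (pi / L)\<^sup>2"
  have s: "s > 0" using L by (simp add: s_def)
  have i1: "(\<lambda>t. (f0 t)\<^sup>2) integrable_on {\<alpha>..\<beta>}" and i2: "(\<lambda>t. F t * f' t) integrable_on {\<alpha>..\<beta>}"
    and i3: "(\<lambda>t. s / 2 * (F t)\<^sup>2) integrable_on {\<alpha>..\<beta>}" and i4: "(\<lambda>t. 1 / (2 * s) * (f' t)\<^sup>2) integrable_on {\<alpha>..\<beta>}"
    by (intro integrable_continuous_real continuous_intros f0c Fc f')+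
  have "- (F t * f' t) \<le> s / 2 * (F t)\<^sup>2 + 1 / (2 * s) * (f' t)\<^sup>2" for t
  proof -
    have "0 \<le> (s * F t + f' t)\<^sup>2" by simp
    then show ?thesis using s by (simp add: field_simps power2_eq_square)
  qed
  then have "integral {\<alpha>..\<beta>} (\<lambda>t. - (F t * f' t)) \<le> integral {\<alpha>..\<beta>} (\<lambda>t. s / 2 * (F t)\<^sup>2 + 1 / (2 * s) * (f' t)\<^sup>2)"
    by (intro integral_le integrable_add i3 i4 integrable_neg i2)
  also have "\<dots> = s / 2 * integral {\<alpha>..\<beta>} (\<lambda>t. (F t)\<^sup>2) + 1 / (2 * s) * integral {\<alpha>..\<beta>} (\<lambda>t. (f' t)\<^sup>2)"
    by (simp only: integral_add[OF i3 i4] integral_mult_right)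
  finally have "integral {\<alpha>..\<beta>} (\<lambda>t. (f0 t)\<^sup>2)
      \<le> s / 2 * integral {\<alpha>..\<beta>} (\<lambda>t. (F t)\<^sup>2) + 1 / (2 * s) * integral {\<alpha>..\<beta>} (\<lambda>t. (f' t)\<^sup>2)"
    using ibp integral_add[OF i1 i2] by simp
  also have "s / 2 * integral {\<alpha>..\<beta>} (\<lambda>t. (F t)\<^sup>2) \<le> integral {\<alpha>..\<beta>} (\<lambda>t. (f0 t)\<^sup>2) / 2"
    using D by (simp add: s_def)
  finally have "integral {\<alpha>..\<beta>} (\<lambda>t. (f0 t)\<^sup>2) \<le> 1 / s * integral {\<alpha>..\<beta>} (\<lambda>t. (f' t)\<^sup>2)"
    by simp
  then show ?thesis using L by (simp add: s_def f0_def L_def power_divide)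
qed

text \<open>The variance of \<open>f\<close> on the interval is nonnegative. On a single line this
  is the reason why averaging does not increase the norm.\<close>

lemma integral_square_mean_le:
  fixes f :: "real \<Rightarrow> real"
  assumes ab: "\<alpha> < \<beta>" and fc: "continuous_on {\<alpha>..\<beta>} f"
  shows "(integral {\<alpha>..\<beta>} f / (\<beta> - \<alpha>))\<^sup>2 \<le> integral {\<alpha>..\<beta>} (\<lambda>t. (f t)\<^sup>2) / (\<beta> - \<alpha>)"
proof -
  define m where "m = integral {\<alpha>..\<beta>} f / (\<beta> - \<alpha>)"
  have i1: "(\<lambda>t. (f t)\<^sup>2) integrable_on {\<alpha>..\<beta>}" and i2: "(\<lambda>t. 2 * m * f t) integrable_on {\<alpha>..\<beta>}"
    by (intro integrable_continuous_real continuous_intros fc)+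
  have "0 \<le> integral {\<alpha>..\<beta>} (\<lambda>t. (f t - m)\<^sup>2)"
    by (intro integral_nonneg integrable_continuous_real continuous_intros fc) auto
  also have "(\<lambda>t. (f t - m)\<^sup>2) = (\<lambda>t. (f t)\<^sup>2 - 2 * m * f t + m\<^sup>2)"
    by (auto simp: power2_eq_square algebra_simps)
  also have "integral {\<alpha>..\<beta>} \<dots> = integral {\<alpha>..\<beta>} (\<lambda>t. (f t)\<^sup>2) - 2 * m * integral {\<alpha>..\<beta>} f + m\<^sup>2 * (\<beta> - \<alpha>)"
    using ab by (subst integral_add[OF integrable_diff[OF i1 i2]], force, subst integral_diff[OF i1 i2]) (simp add: mult.commute)
  also have "\<dots> = integral {\<alpha>..\<beta>} (\<lambda>t. (f t)\<^sup>2) - m\<^sup>2 * (\<beta> - \<alpha>)"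
    using ab by (simp add: m_def power2_eq_square)
  finally show ?thesis using ab by (simp add: m_def[symmetric] field_simps)
qed

section \<open>Averaging along a coordinate direction\<close>

text \<open>Tonelli's theorem with one coordinate singled out: Lebesgue measure is the image of the
  product measure over \<open>Basis\<close>, and the factor belonging to \<open>i\<close> is
  integrated first. For nonnegative integrands no integrability has to be checked.\<close>

lemma nn_integral_lborel_Basis_split:
  fixes h :: "'a::euclidean_space \<Rightarrow> ennreal"
  assumes [measurable]: "h \<in> borel_measurable borel" and i: "i \<in> Basis"
  shows "(\<integral>\<^sup>+x. h x \<partial>lborel) =
    (\<integral>\<^sup>+y. (\<integral>\<^sup>+t. h ((\<Sum>b\<in>Basis - {i}. y b *\<^sub>R b) + t *\<^sub>R i) \<partial>lborel) \<partial>(\<Pi>\<^sub>M b\<in>Basis - {i}. lborel))"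
proof -
  interpret product_sigma_finite "\<lambda>b::'a. lborel :: real measure"
    by standard
  have B: "Basis = insert i (Basis - {i})" using i by auto
  have "(\<integral>\<^sup>+x. h x \<partial>lborel) = (\<integral>\<^sup>+f. h (\<Sum>b\<in>Basis. f b *\<^sub>R b) \<partial>(\<Pi>\<^sub>M b\<in>Basis. lborel))"
    by (subst lborel_eq, subst nn_integral_distr) auto
  also have "\<dots> = (\<integral>\<^sup>+f. h (\<Sum>b\<in>Basis. f b *\<^sub>R b) \<partial>(\<Pi>\<^sub>M b\<in>insert i (Basis - {i}). lborel))"
    using B by simp
  also have "\<dots> = (\<integral>\<^sup>+y. (\<integral>\<^sup>+t. h (\<Sum>b\<in>Basis. (y(i := t)) b *\<^sub>R b) \<partial>lborel) \<partial>(\<Pi>\<^sub>M b\<in>Basis - {i}. lborel))"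
    by (subst product_nn_integral_insert) (use B in auto)
  also have "(\<lambda>y t. \<Sum>b\<in>Basis. (y(i := t)) b *\<^sub>R b) = (\<lambda>y t. (\<Sum>b\<in>Basis - {i}. y b *\<^sub>R b) + t *\<^sub>R i)"
    by (intro ext, subst sum.remove[OF _ i]) (auto intro!: sum.cong simp: add.commute)
  finally show ?thesis .
qed

text \<open>For \<open>i\<close> in \<open>Basis\<close>, the point in the integrand is
  \<open>x\<close> with its i-th coordinate replaced by \<open>t\<close>, so the mean no longer
  depends on that coordinate. It is defined at every point of the space, which allows means in
  different directions to be iterated.\<close>

definition line_mean :: "'a::euclidean_space \<Rightarrow> real \<Rightarrow> real \<Rightarrow> ('a \<Rightarrow> real) \<Rightarrow> 'a \<Rightarrow> real" where
  "line_mean i \<alpha> \<beta> g x = integral {\<alpha>..\<beta>} (\<lambda>t. g (x + (t - x \<bullet> i) *\<^sub>R i)) / (\<beta> - \<alpha>)"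

text \<open>This links the nonnegative Lebesgue integral, in which the coordinates are separated, to
  the gauge integral, in which the inequalities on intervals are phrased.\<close>

lemma nn_integral_cbox_eq_integral:
  fixes g :: "'a::euclidean_space \<Rightarrow> real"
  assumes "continuous_on UNIV g" "\<And>x. 0 \<le> g x"
  shows "(\<integral>\<^sup>+x. ennreal (indicator (cbox c d) x * g x) \<partial>lborel) = ennreal (integral (cbox c d) g)"
proof -
  have i: "integrable lborel (\<lambda>x. indicator (cbox c d) x *\<^sub>R g x)"
    using assms by (intro borel_integrable_compact) (auto intro: continuous_on_subset)
  have "(\<integral>\<^sup>+x. ennreal (indicator (cbox c d) x * g x) \<partial>lborel) = ennreal (LINT x|lborel. indicator (cbox c d) x * g x)"
    using i assms by (intro nn_integral_eq_integral) auto
  also have "(LINT x|lborel. indicator (cbox c d) x * g x) = integral (cbox c d) g"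
    using set_borel_integral_eq_integral(2)[of "cbox c d" g] i
    by (simp add: set_integrable_def set_lebesgue_integral_def)
  finally show ?thesis .
qed

lemma continuous_on_line_mean:
  fixes g :: "'a::euclidean_space \<Rightarrow> real"
  assumes g: "continuous_on UNIV g"
  shows "continuous_on UNIV (line_mean i \<alpha> \<beta> g)"
proof -
  have "continuous_on UNIV (\<lambda>x. integral (cbox \<alpha> \<beta>) (\<lambda>t. g (x + (t - x \<bullet> i) *\<^sub>R i)))"
    by (rule integral_continuous_on_param)
       (auto intro!: continuous_on_compose2[OF g] continuous_intros simp: case_prod_beta)
  then show ?thesis
    unfolding line_mean_def[abs_def] by (cases "\<alpha> = \<beta>") (auto intro!: continuous_intros)
qed

lemma continuous_on_line:
  fixes g :: "'a::euclidean_space \<Rightarrow> real"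
  assumes "continuous_on UNIV g"
  shows "continuous_on A (\<lambda>t. g (z + (t - s) *\<^sub>R i))"
  by (rule continuous_on_compose2[OF assms]) (auto intro!: continuous_intros)

lemma line_mean_diff:
  fixes g h :: "'a::euclidean_space \<Rightarrow> real"
  assumes "continuous_on UNIV g" "continuous_on UNIV h"
  shows "line_mean i \<alpha> \<beta> (\<lambda>x. g x - h x) x = line_mean i \<alpha> \<beta> g x - line_mean i \<alpha> \<beta> h x"
  unfolding line_mean_def
  by (subst integral_diff) (auto intro!: integrable_continuous_real continuous_on_line assms simp: diff_divide_distrib)

text \<open>On each line parallel to \<open>i\<close> the function and its mean have the same
  integral over the segment inside the box; integrating over the remaining coordinates gives the
  claim. Nonnegativity of \<open>g\<close> permits computing in \<open>ennreal\<close> and returning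
  to the reals at the end.\<close>

lemma integral_cbox_line_mean:
  fixes g :: "'a::euclidean_space \<Rightarrow> real"
  assumes cd: "\<And>j. j \<in> Basis \<Longrightarrow> c \<bullet> j < d \<bullet> j" and i: "i \<in> Basis"
    and g: "continuous_on UNIV g" "\<And>x. 0 \<le> g x"
  shows "integral (cbox c d) (line_mean i (c \<bullet> i) (d \<bullet> i) g) = integral (cbox c d) g"
proof -
  let ?\<alpha> = "c \<bullet> i" and ?\<beta> = "d \<bullet> i"
  let ?m = "line_mean i ?\<alpha> ?\<beta> g"
  let ?P = "\<Pi>\<^sub>M b\<in>Basis - {i}. (lborel :: real measure)"
  define z where "z y = (\<Sum>b\<in>Basis - {i}. y b *\<^sub>R b)" for y :: "'a \<Rightarrow> real"
  \<comment> \<open>\<open>I y\<close> records whether the line through \<open>z y\<close> in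
    direction \<open>i\<close> meets the box. The indicator of the box restricted to that line is
    then \<open>I y\<close> times the indicator of a fixed interval.\<close>
  define I where "I y = (if \<forall>b\<in>Basis - {i}. c \<bullet> b \<le> y b \<and> y b \<le> d \<bullet> b then 1 else 0 :: real)" for y
  have mc: "continuous_on UNIV ?m" by (rule continuous_on_line_mean[OF g(1)])
  have m0: "0 \<le> ?m x" for x
    unfolding line_mean_def using cd[OF i]
    by (intro divide_nonneg_pos integral_nonneg integrable_continuous_real continuous_on_line g) auto
  have zi: "z y \<bullet> i = 0" for y
    using i by (auto simp: z_def inner_sum_left inner_Basis intro!: sum.neutral)
  have zb: "z y \<bullet> b = y b" if "b \<in> Basis" "b \<noteq> i" for y b
  proof -
    have "z y \<bullet> b = (\<Sum>b'\<in>Basis - {i}. if b' = b then y b' else 0)"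
      unfolding z_def inner_sum_left using that by (intro sum.cong) (auto simp: inner_Basis)
    then show ?thesis using that by simp
  qed
  have ind: "indicator (cbox c d) (z y + t *\<^sub>R i) = I y * indicator {?\<alpha>..?\<beta>} t" for y t
  proof -
    have "z y + t *\<^sub>R i \<in> cbox c d \<longleftrightarrow> (\<forall>b\<in>Basis - {i}. c \<bullet> b \<le> y b \<and> y b \<le> d \<bullet> b) \<and> t \<in> {?\<alpha>..?\<beta>}"
      unfolding mem_box using i zi zb by (force simp: inner_add_left inner_Basis)
    then show ?thesis by (simp add: I_def indicator_def)
  qed
  have gl: "continuous_on UNIV (\<lambda>t. I y * g (z y + t *\<^sub>R i))" for y
    using continuous_on_line[OF g(1), of UNIV "z y" 0] by (auto intro!: continuous_intros)
  have split: "ennreal (integral (cbox c d) h) =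
      (\<integral>\<^sup>+y. \<integral>\<^sup>+t. ennreal (indicator {?\<alpha>..?\<beta>} t * (I y * h (z y + t *\<^sub>R i))) \<partial>lborel \<partial>?P)"
    if h: "continuous_on UNIV h" "\<And>x. 0 \<le> h x" for h :: "'a \<Rightarrow> real"
  proof -
    have [measurable]: "h \<in> borel_measurable borel" by (rule borel_measurable_continuous_onI[OF h(1)])
    have "ennreal (integral (cbox c d) h) = (\<integral>\<^sup>+x. ennreal (indicator (cbox c d) x * h x) \<partial>lborel)"
      using nn_integral_cbox_eq_integral[OF h] by simp
    also have "\<dots> = (\<integral>\<^sup>+y. \<integral>\<^sup>+t. ennreal (indicator (cbox c d) (z y + t *\<^sub>R i) * h (z y + t *\<^sub>R i)) \<partial>lborel \<partial>?P)"
      by (subst nn_integral_lborel_Basis_split[OF _ i]) (auto simp: z_def)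
    finally show ?thesis by (simp add: ind mult_ac)
  qed
  have "(\<integral>\<^sup>+t. ennreal (indicator {?\<alpha>..?\<beta>} t * (I y * g (z y + t *\<^sub>R i))) \<partial>lborel)
      = (\<integral>\<^sup>+t. ennreal (indicator {?\<alpha>..?\<beta>} t * (I y * ?m (z y + t *\<^sub>R i))) \<partial>lborel)" for y
  proof -
    have mz: "?m (z y + t *\<^sub>R i) = ?m (z y)" for t
      using i by (simp add: line_mean_def inner_add_left zi scaleR_add_left[symmetric] add.assoc)
    have I0: "0 \<le> I y" by (simp add: I_def)
    have "(\<integral>\<^sup>+t. ennreal (indicator {?\<alpha>..?\<beta>} t * (I y * g (z y + t *\<^sub>R i))) \<partial>lborel)
      = ennreal (integral {?\<alpha>..?\<beta>} (\<lambda>t. I y * g (z y + t *\<^sub>R i)))"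
      using nn_integral_cbox_eq_integral[OF gl, of y ?\<alpha> ?\<beta>] I0 g(2) by simp
    also have "integral {?\<alpha>..?\<beta>} (\<lambda>t. I y * g (z y + t *\<^sub>R i)) = integral {?\<alpha>..?\<beta>} (\<lambda>t. I y * ?m (z y))"
      using cd[OF i] by (simp add: line_mean_def zi)
    also have "ennreal \<dots> = (\<integral>\<^sup>+t. ennreal (indicator {?\<alpha>..?\<beta>} t * (I y * ?m (z y))) \<partial>lborel)"
      using nn_integral_cbox_eq_integral[of "\<lambda>t. I y * ?m (z y)" ?\<alpha> ?\<beta>] I0 m0 by simp
    finally show ?thesis by (simp add: mz)
  qed
  then have "ennreal (integral (cbox c d) ?m) = ennreal (integral (cbox c d) g)"
    unfolding split[OF g] split[OF mc m0] by simp
  moreover have "0 \<le> integral (cbox c d) ?m" "0 \<le> integral (cbox c d) g"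
    using mc g m0 by (auto intro!: integral_nonneg integrable_continuous intro: continuous_on_subset)
  ultimately show ?thesis by (simp add: ennreal_inj)
qed

section \<open>The space of square integrable functions\<close>

lemma L2_spaceD:
  assumes "f \<in> L2_space S"
  shows "f \<in> borel_measurable (lebesgue_on S)" "integrable (lebesgue_on S) (\<lambda>x. (norm (f x))\<^sup>2)"
  using assms by (auto simp: L2_space_def)

lemma L2_space_bound:
  assumes f: "f \<in> borel_measurable (lebesgue_on S)"
    and h: "integrable (lebesgue_on S) h"
    and le: "AE x in lebesgue_on S. (norm (f x))\<^sup>2 \<le> h x"
  shows "f \<in> L2_space S"
  unfolding L2_space_def
proof (intro CollectI conjI f Bochner_Integration.integrable_bound[OF h])
  show "(\<lambda>x. (norm (f x))\<^sup>2) \<in> borel_measurable (lebesgue_on S)" using f by measurable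
  show "AE x in lebesgue_on S. norm ((norm (f x))\<^sup>2) \<le> norm (h x)"
    using le by eventually_elim auto
qed

lemma L2_space_add:
  assumes f: "f \<in> L2_space S" and g: "g \<in> L2_space S"
  shows "(\<lambda>x. f x + g x) \<in> L2_space S"
proof (rule L2_space_bound)
  show "(\<lambda>x. f x + g x) \<in> borel_measurable (lebesgue_on S)"
    using f g by (intro borel_measurable_add) (auto simp: L2_space_def)
  show "integrable (lebesgue_on S) (\<lambda>x. 2 * (norm (f x))\<^sup>2 + 2 * (norm (g x))\<^sup>2)"
    using f g by (intro Bochner_Integration.integrable_add integrable_mult_right) (auto simp: L2_space_def)
  have "(norm (f x + g x))\<^sup>2 \<le> 2 * (norm (f x))\<^sup>2 + 2 * (norm (g x))\<^sup>2" for x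
  proof -
    have "(norm (f x + g x))\<^sup>2 \<le> (norm (f x) + norm (g x))\<^sup>2"
      by (intro power_mono norm_triangle_ineq) auto
    also have "\<dots> \<le> 2 * (norm (f x))\<^sup>2 + 2 * (norm (g x))\<^sup>2"
      using sum_squares_bound[of "norm (f x)" "norm (g x)"] by (simp add: power2_sum)
    finally show ?thesis .
  qed
  then show "AE x in lebesgue_on S. (norm (f x + g x))\<^sup>2 \<le> 2 * (norm (f x))\<^sup>2 + 2 * (norm (g x))\<^sup>2"
    by simp
qed

lemma L2_space_scaleR:
  assumes f: "f \<in> L2_space S"
  shows "(\<lambda>x. c *\<^sub>R f x) \<in> L2_space S"
proof -
  have "f \<in> borel_measurable (lebesgue_on S)" using f by (rule L2_spaceD)
  moreover have "integrable (lebesgue_on S) (\<lambda>x. c\<^sup>2 * (norm (f x))\<^sup>2)"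
    using L2_spaceD(2)[OF f] by (rule integrable_mult_right)
  ultimately show ?thesis unfolding L2_space_def by (auto simp: power_mult_distrib)
qed

lemma L2_space_cmult:
  fixes f :: "'a::euclidean_space \<Rightarrow> real"
  shows "f \<in> L2_space S \<Longrightarrow> (\<lambda>x. c * f x) \<in> L2_space S"
  using L2_space_scaleR[of f S c] by simp

lemma L2_space_diff:
  assumes "f \<in> L2_space S" "g \<in> L2_space S"
  shows "(\<lambda>x. f x - g x) \<in> L2_space S"
  using L2_space_add[OF assms(1) L2_space_scaleR[OF assms(2), of "-1"]] by simp

lemma L2_space_zero: "(\<lambda>x. 0) \<in> L2_space S"
  by (simp add: L2_space_def)

lemma L2_space_sum:
  assumes "finite A" "\<And>k. k \<in> A \<Longrightarrow> f k \<in> L2_space S"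
  shows "(\<lambda>x. \<Sum>k\<in>A. f k x) \<in> L2_space S"
  using assms by (induction A rule: finite_induct) (auto intro: L2_space_add L2_space_zero)

lemma L2_space_inner_const:
  assumes f: "f \<in> L2_space S"
  shows "(\<lambda>x. f x \<bullet> i) \<in> L2_space S"
proof (rule L2_space_bound)
  show "(\<lambda>x. f x \<bullet> i) \<in> borel_measurable (lebesgue_on S)" 
    using L2_spaceD(1)[OF f] by measurable
  show "integrable (lebesgue_on S) (\<lambda>x. (norm i)\<^sup>2 * (norm (f x))\<^sup>2)"
    using L2_spaceD(2)[OF f] by (rule integrable_mult_right)
  show "AE x in lebesgue_on S. (norm (f x \<bullet> i))\<^sup>2 \<le> (norm i)\<^sup>2 * (norm (f x))\<^sup>2"
    unfolding power_mult_distrib[symmetric]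
    by (intro AE_I2 power_mono) (auto simp: mult.commute[of "norm i"] Cauchy_Schwarz_ineq2)
qed

lemma L2_space_mult_bounded:
  fixes f g :: "'a::euclidean_space \<Rightarrow> real"
  assumes f: "f \<in> L2_space S" and g: "g \<in> borel_measurable (lebesgue_on S)"
    and M: "AE x in lebesgue_on S. \<bar>g x\<bar> \<le> M"
  shows "(\<lambda>x. g x * f x) \<in> L2_space S"
proof (rule L2_space_bound)
  show "(\<lambda>x. g x * f x) \<in> borel_measurable (lebesgue_on S)" 
    using L2_spaceD(1)[OF f] g by measurable
  show "integrable (lebesgue_on S) (\<lambda>x. M\<^sup>2 * (norm (f x))\<^sup>2)"
    using L2_spaceD(2)[OF f] by (rule integrable_mult_right)
  show "AE x in lebesgue_on S. (norm (g x * f x))\<^sup>2 \<le> M\<^sup>2 * (norm (f x))\<^sup>2"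
    using M
  proof eventually_elim
    case (elim x)
    then have "(g x)\<^sup>2 \<le> M\<^sup>2" by (metis abs_ge_zero power2_abs power_mono)
    then show ?case by (simp add: power_mult_distrib mult_right_mono)
  qed
qed

lemma integrable_L2_inner:
  assumes f: "f \<in> L2_space S" and g: "g \<in> L2_space S"
  shows "integrable (lebesgue_on S) (\<lambda>x. f x \<bullet> g x)"
proof (rule Bochner_Integration.integrable_bound)
  show "integrable (lebesgue_on S) (\<lambda>x. (norm (f x))\<^sup>2 + (norm (g x))\<^sup>2)"
    using f g by (intro Bochner_Integration.integrable_add) (auto simp: L2_space_def)
  show "(\<lambda>x. f x \<bullet> g x) \<in> borel_measurable (lebesgue_on S)"
    using L2_spaceD(1)[OF f] L2_spaceD(1)[OF g] by measurable
  have "norm (f x \<bullet> g x) \<le> norm ((norm (f x))\<^sup>2 + (norm (g x))\<^sup>2)" for x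
  proof -
    have "norm (f x \<bullet> g x) \<le> norm (f x) * norm (g x)" by (simp add: Cauchy_Schwarz_ineq2)
    also have "\<dots> \<le> (norm (f x))\<^sup>2 + (norm (g x))\<^sup>2"
      using sum_squares_bound[of "norm (f x)" "norm (g x)"]
        mult_nonneg_nonneg[OF norm_ge_zero[of "f x"] norm_ge_zero[of "g x"]] by linarith
    finally show ?thesis by simp
  qed
  then show "AE x in lebesgue_on S. norm (f x \<bullet> g x) \<le> norm ((norm (f x))\<^sup>2 + (norm (g x))\<^sup>2)" by simp
qed

lemma L2_inner_commute: "L2_inner S f g = L2_inner S g f"
  by (simp add: L2_inner_def inner_commute)

lemma L2_inner_add_left:
  assumes "f \<in> L2_space S" "g \<in> L2_space S" "h \<in> L2_space S"
  shows "L2_inner S (\<lambda>x. f x + g x) h = L2_inner S f h + L2_inner S g h"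
  unfolding L2_inner_def inner_add_left
  using assms by (intro Bochner_Integration.integral_add integrable_L2_inner)

lemma L2_inner_diff_left:
  assumes "f \<in> L2_space S" "g \<in> L2_space S" "h \<in> L2_space S"
  shows "L2_inner S (\<lambda>x. f x - g x) h = L2_inner S f h - L2_inner S g h"
  unfolding L2_inner_def inner_diff_left
  using assms by (intro Bochner_Integration.integral_diff integrable_L2_inner)

lemma L2_inner_diff_right:
  assumes "f \<in> L2_space S" "g \<in> L2_space S" "h \<in> L2_space S"
  shows "L2_inner S h (\<lambda>x. f x - g x) = L2_inner S h f - L2_inner S h g"
  using L2_inner_diff_left[OF assms] by (simp add: L2_inner_commute)

lemma L2_inner_scaleR_left: "L2_inner S (\<lambda>x. c *\<^sub>R f x) g = c * L2_inner S f g"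
  by (simp add: L2_inner_def)

lemma L2_inner_add_right:
  assumes "f \<in> L2_space S" "g \<in> L2_space S" "h \<in> L2_space S"
  shows "L2_inner S h (\<lambda>x. f x + g x) = L2_inner S h f + L2_inner S h g"
  using L2_inner_add_left[OF assms] by (simp add: L2_inner_commute)

lemma L2_inner_scaleR_right: "L2_inner S f (\<lambda>x. c *\<^sub>R g x) = c * L2_inner S f g"
  by (simp add: L2_inner_def)

lemma L2_inner_AE_cong:
  assumes "AE x in lebesgue_on S. f x \<bullet> g x = f' x \<bullet> g' x"
    and "f \<in> L2_space S" "g \<in> L2_space S" "f' \<in> L2_space S" "g' \<in> L2_space S"
  shows "L2_inner S f g = L2_inner S f' g'"
  unfolding L2_inner_def
  using assms by (intro integral_cong_AE borel_measurable_integrable integrable_L2_inner) auto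

lemma L2_inner_self_nonneg: "0 \<le> L2_inner S f f"
  by (simp add: L2_inner_def)

lemma L2_norm_nonneg: "0 \<le> L2_norm S f"
  by (simp add: L2_norm_def L2_inner_self_nonneg)

lemma L2_norm_square: "(L2_norm S f)\<^sup>2 = L2_inner S f f"
  by (simp add: L2_norm_def L2_inner_self_nonneg)

lemma L2_Cauchy_Schwarz:
  assumes f: "f \<in> L2_space S" and g: "g \<in> L2_space S"
  shows "\<bar>L2_inner S f g\<bar> \<le> L2_norm S f * L2_norm S g"
proof -
  let ?a = "L2_inner S f f" and ?b = "L2_inner S f g" and ?c = "L2_inner S g g"
  have q: "0 \<le> ?a - 2 * t * ?b + t\<^sup>2 * ?c" for t
  proof -
    note tg = L2_space_scaleR[OF g, of t]
    have "0 \<le> L2_inner S (\<lambda>x. f x - t *\<^sub>R g x) (\<lambda>x. f x - t *\<^sub>R g x)" by (rule L2_inner_self_nonneg)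
    also have "\<dots> = ?a - 2 * t * ?b + t\<^sup>2 * ?c"
      by (simp add: L2_inner_diff_left[OF f tg L2_space_diff[OF f tg]]
          L2_inner_diff_right[OF f tg f] L2_inner_diff_right[OF f tg g] L2_inner_scaleR_left
          L2_inner_scaleR_right L2_inner_commute[of S g f] power2_eq_square algebra_simps)
    finally show ?thesis .
  qed
  have "?b\<^sup>2 \<le> ?a * ?c"
  proof (cases "?c = 0")
    case True
    have "?b = 0"
    proof (rule ccontr)
      assume "?b \<noteq> 0"
      \<comment> \<open>With \<open>?c = 0\<close> the quadratic in \<open>t\<close> degenerates to
        an affine function, and at this \<open>t\<close> its value is -1. The case does occur, since
        functions are not identified almost everywhere.\<close>
      then show False using q[of "(?a + 1) / (2 * ?b)"] True by simp
    qed
    then show ?thesis using True by simp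
  next
    case False
    then have "?c > 0" using L2_inner_self_nonneg[of S g] by simp
    then show ?thesis using q[of "?b / ?c"] by (simp add: field_simps power2_eq_square)
  qed
  then have "\<bar>?b\<bar>\<^sup>2 \<le> (L2_norm S f * L2_norm S g)\<^sup>2"
    by (simp add: power_mult_distrib L2_norm_square)
  then show ?thesis
    by (rule power2_le_imp_le) (simp add: L2_norm_nonneg)
qed

lemma L2_norm_triangle:
  assumes f: "f \<in> L2_space S" and g: "g \<in> L2_space S"
  shows "L2_norm S (\<lambda>x. f x + g x) \<le> L2_norm S f + L2_norm S g"
proof (rule power2_le_imp_le)
  note fg = L2_space_add[OF f g]
  have "(L2_norm S (\<lambda>x. f x + g x))\<^sup>2 = L2_inner S f f + 2 * L2_inner S f g + L2_inner S g g"
    by (simp add: L2_norm_square L2_inner_add_left[OF f g fg] L2_inner_add_right[OF f g f]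
        L2_inner_add_right[OF f g g] L2_inner_commute[of S g f])
  also have "\<dots> \<le> (L2_norm S f + L2_norm S g)\<^sup>2"
    using L2_Cauchy_Schwarz[OF f g] by (simp add: power2_sum L2_norm_square)
  finally show "(L2_norm S (\<lambda>x. f x + g x))\<^sup>2 \<le> (L2_norm S f + L2_norm S g)\<^sup>2" .
qed (simp add: L2_norm_nonneg)

lemma L2_norm_minus_commute: "L2_norm S (\<lambda>x. f x - g x) = L2_norm S (\<lambda>x. g x - f x)"
  by (simp add: L2_norm_def L2_inner_def power2_norm_eq_inner[symmetric] norm_minus_commute)

lemma L2_norm_diff_ineq:
  assumes f: "f \<in> L2_space S" and g: "g \<in> L2_space S"
  shows "\<bar>L2_norm S f - L2_norm S g\<bar> \<le> L2_norm S (\<lambda>x. f x - g x)"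
  using L2_norm_triangle[OF L2_space_diff[OF f g] g] L2_norm_triangle[OF L2_space_diff[OF g f] f]
  by (simp add: L2_norm_minus_commute[of S g f])

lemma tendsto_L2_inner_right:
  assumes f: "f \<in> L2_space S" and v: "v \<in> L2_space S" and \<phi>: "\<And>n. \<phi> n \<in> L2_space S"
    and lim: "(\<lambda>n::nat. L2_norm S (\<lambda>x. v x - \<phi> n x)) \<longlonglongrightarrow> 0"
  shows "(\<lambda>n. L2_inner S f (\<phi> n)) \<longlonglongrightarrow> L2_inner S f v"
proof (rule LIM_zero_cancel, rule Lim_null_comparison)
  show "\<forall>\<^sub>F n in sequentially. norm (L2_inner S f (\<phi> n) - L2_inner S f v) \<le> L2_norm S f * L2_norm S (\<lambda>x. v x - \<phi> n x)"
    using L2_Cauchy_Schwarz[OF f L2_space_diff[OF v \<phi>]]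
    by (intro always_eventually allI) (simp add: L2_inner_diff_right[OF v \<phi> f] abs_minus_commute)
  show "(\<lambda>n. L2_norm S f * L2_norm S (\<lambda>x. v x - \<phi> n x)) \<longlonglongrightarrow> 0"
    using tendsto_mult_right_zero[OF lim] by simp
qed

lemma tendsto_L2_norm:
  assumes v: "v \<in> L2_space S" and \<phi>: "\<And>n. \<phi> n \<in> L2_space S"
    and lim: "(\<lambda>n::nat. L2_norm S (\<lambda>x. v x - \<phi> n x)) \<longlonglongrightarrow> 0"
  shows "(\<lambda>n. L2_norm S (\<phi> n)) \<longlonglongrightarrow> L2_norm S v"
proof (rule LIM_zero_cancel, rule Lim_null_comparison[OF _ lim])
  show "\<forall>\<^sub>F n in sequentially. norm (L2_norm S (\<phi> n) - L2_norm S v) \<le> L2_norm S (\<lambda>x. v x - \<phi> n x)"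
    using L2_norm_diff_ineq[OF v \<phi>]
    by (intro always_eventually allI) (simp add: abs_minus_commute)
qed

section \<open>Orthogonal projection onto the span of finitely many functions\<close>

lemma L2_inner_sum_right:
  fixes B :: "'b \<Rightarrow> 'a::euclidean_space \<Rightarrow> real"
  assumes "\<And>k. k \<in> I \<Longrightarrow> B k \<in> L2_space S" "f \<in> L2_space S"
  shows "L2_inner S f (\<lambda>x. \<Sum>k\<in>I. e k * B k x) = (\<Sum>k\<in>I. e k * L2_inner S f (B k))"
  unfolding L2_inner_def inner_sum_right
  using integrable_L2_inner[OF assms(2) assms(1)]
  by (subst Bochner_Integration.integral_sum) (auto simp: sum_distrib_left mult.left_commute)

text \<open>Gram-Schmidt as an induction over the index set: \<open>h\<close> is the part of the new
  function orthogonal to the earlier ones, and the old residual \<open>g'\<close> is corrected by a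
  multiple of \<open>h\<close>. Linear independence is not assumed, so \<open>h\<close> may have
  norm zero.\<close>

lemma L2_projection_exists:
  fixes B :: "'b \<Rightarrow> 'a::euclidean_space \<Rightarrow> real"
  assumes "finite I" "\<And>k. k \<in> I \<Longrightarrow> B k \<in> L2_space S" "g \<in> L2_space S"
  shows "\<exists>c. \<forall>k\<in>I. L2_inner S (\<lambda>x. g x - (\<Sum>k\<in>I. c k * B k x)) (B k) = 0"
  using assms
proof (induction I arbitrary: g rule: finite_induct)
  case empty
  then show ?case by simp
next
  case (insert j I)
  have BI: "B k \<in> L2_space S" if "k \<in> I" for k using insert.prems that by simp
  have Bj: "B j \<in> L2_space S" using insert.prems by simp
  have lin: "(\<lambda>x. \<Sum>k\<in>I. a k * B k x) \<in> L2_space S" for a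
    by (intro L2_space_sum insert.hyps L2_space_cmult BI)
  obtain c where c: "\<And>k. k \<in> I \<Longrightarrow> L2_inner S (\<lambda>x. g x - (\<Sum>k\<in>I. c k * B k x)) (B k) = 0"
    using insert.IH[OF BI insert.prems(2)] by blast
  obtain e where e: "\<And>k. k \<in> I \<Longrightarrow> L2_inner S (\<lambda>x. B j x - (\<Sum>k\<in>I. e k * B k x)) (B k) = 0"
    using insert.IH[OF BI Bj] by blast
  define g' where "g' x = g x - (\<Sum>k\<in>I. c k * B k x)" for x
  define h where "h x = B j x - (\<Sum>k\<in>I. e k * B k x)" for x
  have g': "g' \<in> L2_space S" and h: "h \<in> L2_space S"
    unfolding g'_def[abs_def] h_def[abs_def]
    using L2_space_diff[OF insert.prems(2) lin] L2_space_diff[OF Bj lin] by auto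
  have orth: "L2_inner S f h = L2_inner S f (B j)"
    if f: "f \<in> L2_space S" and o: "\<And>k. k \<in> I \<Longrightarrow> L2_inner S f (B k) = 0" for f
  proof -
    have "L2_inner S f (\<lambda>x. \<Sum>k\<in>I. e k * B k x) = (\<Sum>k\<in>I. e k * L2_inner S f (B k))"
      by (rule L2_inner_sum_right[OF BI f])
    then show ?thesis
      unfolding h_def[abs_def] L2_inner_diff_right[OF Bj lin f] using o by simp
  qed
  \<comment> \<open>If \<open>h\<close> has norm zero, division by zero gives \<open>s = 0\<close>;
    the residual is then orthogonal to \<open>h\<close> already, by Cauchy-Schwarz.\<close>
  define s where "s = L2_inner S g' h / L2_inner S h h"
  define b where "b k = (if k = j then s else c k - s * e k)" for k
  have eq: "(\<lambda>x. g x - (\<Sum>k\<in>insert j I. b k * B k x)) = (\<lambda>x. g' x - s *\<^sub>R h x)"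
  proof
    fix x
    have "(\<Sum>k\<in>I. b k * B k x) = (\<Sum>k\<in>I. c k * B k x) - s * (\<Sum>k\<in>I. e k * B k x)"
      unfolding sum_distrib_left sum_subtractf[symmetric]
      using insert.hyps by (intro sum.cong) (auto simp: b_def algebra_simps)
    then show "g x - (\<Sum>k\<in>insert j I. b k * B k x) = g' x - s *\<^sub>R h x"
      using insert.hyps by (simp add: g'_def h_def b_def algebra_simps)
  qed
  have sh: "(\<lambda>x. s *\<^sub>R h x) \<in> L2_space S" by (rule L2_space_scaleR[OF h])
  have oI: "L2_inner S (\<lambda>x. g' x - s *\<^sub>R h x) (B k) = 0" if "k \<in> I" for k
    using c[OF that] e[OF that]
    by (simp add: L2_inner_diff_left[OF g' sh BI[OF that], unfolded real_scaleR_def] L2_inner_scaleR_left[where 'b=real, unfolded real_scaleR_def] g'_def[symmetric] h_def[symmetric])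
  have "L2_inner S g' h = s * L2_inner S h h"
  proof (cases "L2_inner S h h = 0")
    case True
    then show ?thesis using L2_Cauchy_Schwarz[OF g' h] by (simp add: L2_norm_def)
  qed (simp add: s_def)
  then have "L2_inner S (\<lambda>x. g' x - s *\<^sub>R h x) h = 0"
    by (simp only: L2_inner_diff_left[OF g' sh h] L2_inner_scaleR_left)
  then have "L2_inner S (\<lambda>x. g' x - s *\<^sub>R h x) (B j) = 0"
    using orth[OF L2_space_diff[OF g' sh] oI] by simp
  then show ?case using oI eq by (intro exI[of _ b]) auto
qed

section \<open>Restriction to subsets, up to null sets\<close>

text \<open>The set \<open>K\<close> need not lie inside \<open>S\<close>: the domain is an open box
  while mesh elements are closed, so an element may contain boundary points of the domain. These
  form a null set.\<close>

lemma AE_lebesgue_on_subset: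
  assumes S: "S \<in> sets lebesgue" and K: "K \<in> sets lebesgue" and N: "negligible (K - S)"
    and ae: "AE x in lebesgue_on S. P x"
  shows "AE x in lebesgue_on K. P x"
proof -
  have "AE x in lebesgue. x \<in> S \<longrightarrow> P x"
    using ae S by (simp add: AE_restrict_space_iff)
  moreover have "AE x in lebesgue. x \<notin> K - S"
    using N by (intro AE_not_in) (simp add: negligible_iff_null_sets)
  ultimately have "AE x in lebesgue. x \<in> K \<longrightarrow> P x"
    by eventually_elim auto
  then show ?thesis using K by (simp add: AE_restrict_space_iff)
qed

lemma borel_measurable_lebesgue_on_subset:
  assumes S: "S \<in> sets lebesgue" and K: "K \<in> sets lebesgue" and N: "negligible (K - S)"
    and f: "f \<in> borel_measurable (lebesgue_on S)"
  shows "f \<in> borel_measurable (lebesgue_on K)"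
proof (rule measurableI)
  fix A :: "'b set" assume A: "A \<in> sets borel"
  have 1: "f -` A \<inter> S \<in> sets lebesgue"
    using measurable_sets[OF f A] S by (auto simp: sets_restrict_space_iff)
  \<comment> \<open>Every subset of a negligible set is Lebesgue measurable, so the values of
    \<open>f\<close> on \<open>K - S\<close> are irrelevant.\<close>
  have 2: "f -` A \<inter> (K - S) \<in> sets lebesgue"
    using negligible_subset[OF N, of "f -` A \<inter> (K - S)"] by (auto intro: negligible_imp_sets)
  have "f -` A \<inter> K = (f -` A \<inter> S) \<inter> K \<union> f -` A \<inter> (K - S)" by auto
  also have "\<dots> \<in> sets lebesgue" using 1 2 K by blast
  finally show "f -` A \<inter> space (lebesgue_on K) \<in> sets (lebesgue_on K)"
    using K by (simp add: sets_restrict_space_iff)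
qed simp

lemma L2_space_subset:
  fixes f :: "'a::euclidean_space \<Rightarrow> 'b::euclidean_space"
  assumes S: "S \<in> sets lebesgue" and K: "K \<in> sets lebesgue" and N: "negligible (K - S)"
    and f: "f \<in> L2_space S"
  shows "f \<in> L2_space K"
proof -
  have m: "f \<in> borel_measurable (lebesgue_on K)"
    by (rule borel_measurable_lebesgue_on_subset[OF S K N L2_spaceD(1)[OF f]])
  have "integrable lebesgue (\<lambda>x. indicator S x *\<^sub>R (norm (f x))\<^sup>2)"
    using L2_spaceD(2)[OF f] S by (simp add: integrable_restrict_space)
  then have i1: "integrable lebesgue (\<lambda>x. indicator K x *\<^sub>R (indicator S x *\<^sub>R (norm (f x))\<^sup>2))"
    by (rule integrable_mult_indicator[OF K])
  have m1: "(\<lambda>x. indicator K x *\<^sub>R (norm (f x))\<^sup>2) \<in> borel_measurable lebesgue"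
    using m K by (subst borel_measurable_restrict_space_iff[symmetric]) auto
  have "AE x in lebesgue. x \<notin> K - S"
    using N by (intro AE_not_in) (simp add: negligible_iff_null_sets)
  then have ae: "AE x in lebesgue. indicator K x *\<^sub>R (indicator S x *\<^sub>R (norm (f x))\<^sup>2) = indicator K x *\<^sub>R (norm (f x))\<^sup>2"
    by eventually_elim (auto split: split_indicator)
  have "integrable lebesgue (\<lambda>x. indicator K x *\<^sub>R (norm (f x))\<^sup>2)"
    using integrable_cong_AE[OF borel_measurable_integrable[OF i1] m1 ae] i1 by blast
  then show ?thesis using m K by (simp add: L2_space_def integrable_restrict_space)
qed

lemma L2_inner_eq_integral:
  assumes "S \<in> sets lebesgue" "f \<in> L2_space S" "g \<in> L2_space S"
  shows "L2_inner S f g = integral S (\<lambda>x. f x \<bullet> g x)"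
  unfolding L2_inner_def using assms by (intro lebesgue_integral_eq_integral integrable_L2_inner)

lemma L2_space_continuous:
  fixes f :: "'a::euclidean_space \<Rightarrow> 'b::euclidean_space"
  assumes f: "continuous_on UNIV f"
  shows "f \<in> L2_space (cbox c d)"
proof -
  have c: "continuous_on (cbox c d) f" using f by (rule continuous_on_subset) simp
  then show ?thesis
    unfolding L2_space_def
    by (auto intro!: continuous_imp_measurable_on_sets_lebesgue continuous_imp_integrable continuous_intros)
qed

lemma L2_norm_continuous:
  fixes f :: "'a::euclidean_space \<Rightarrow> real"
  assumes f: "continuous_on UNIV f"
  shows "(L2_norm (cbox c d) f)\<^sup>2 = integral (cbox c d) (\<lambda>x. (f x)\<^sup>2)"
  unfolding L2_norm_square
  using L2_inner_eq_integral[OF _ L2_space_continuous[OF f] L2_space_continuous[OF f], of c d]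
  by (simp add: power2_eq_square)

section \<open>Poincare and Friedrichs inequalities on a box\<close>

lemma Ck_1D:
  fixes \<phi> :: "'a::euclidean_space \<Rightarrow> real"
  assumes "Ck (Suc 0) \<phi>"
  shows "continuous_on UNIV \<phi>" "\<And>x. (\<phi> has_derivative frechet_derivative \<phi> (at x)) (at x)"
    "\<And>i. i \<in> Basis \<Longrightarrow> continuous_on UNIV (partial_deriv i \<phi>)"
  using assms
  by (auto simp: frechet_derivative_works[symmetric] continuous_on_eq_continuous_within differentiable_imp_continuous_within)

lemma has_field_derivative_line:
  fixes \<phi> :: "'a::euclidean_space \<Rightarrow> real"
  assumes "Ck (Suc 0) \<phi>"
  shows "((\<lambda>t. \<phi> (x + (t - s) *\<^sub>R i)) has_field_derivative partial_deriv i \<phi> (x + (t - s) *\<^sub>R i)) (at t within A)"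
proof -
  let ?D = "frechet_derivative \<phi> (at (x + (t - s) *\<^sub>R i))"
  have D: "(\<phi> has_derivative ?D) (at (x + (t - s) *\<^sub>R i))" by (rule Ck_1D(2)[OF assms])
  interpret bounded_linear ?D using D by (rule has_derivative_bounded_linear)
  have "((\<lambda>t. x + (t - s) *\<^sub>R i) has_derivative (\<lambda>h. h *\<^sub>R i)) (at t within A)"
    by (auto intro!: derivative_eq_intros)
  from has_derivative_compose[OF this D] show ?thesis
    by (simp add: has_field_derivative_def partial_deriv_def scaleR mult_commute_abs)
qed

lemma continuous_on_grad:
  fixes \<phi> :: "'a::euclidean_space \<Rightarrow> real"
  assumes "Ck (Suc 0) \<phi>"
  shows "continuous_on UNIV (grad \<phi>)"
  unfolding grad_def[abs_def] using Ck_1D(3)[OF assms] by (auto intro!: continuous_intros)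

lemma grad_inner_Basis: "i \<in> Basis \<Longrightarrow> grad \<phi> x \<bullet> i = partial_deriv i \<phi> x"
  unfolding grad_def by (rule inner_sum_left_Basis)

lemma L2_norm_grad:
  fixes \<phi> :: "'a::euclidean_space \<Rightarrow> real"
  assumes "Ck (Suc 0) \<phi>"
  shows "(L2_norm (cbox c d) (grad \<phi>))\<^sup>2 = (\<Sum>i\<in>Basis. (L2_norm (cbox c d) (partial_deriv i \<phi>))\<^sup>2)"
proof -
  have "(L2_norm (cbox c d) (grad \<phi>))\<^sup>2 = (LINT x|lebesgue_on (cbox c d). (\<Sum>i\<in>Basis. partial_deriv i \<phi> x * partial_deriv i \<phi> x))"
    unfolding L2_norm_square L2_inner_def by (subst euclidean_inner) (simp add: grad_inner_Basis)
  also have "\<dots> = (\<Sum>i\<in>Basis. LINT x|lebesgue_on (cbox c d). partial_deriv i \<phi> x * partial_deriv i \<phi> x)"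
  proof (rule Bochner_Integration.integral_sum)
    fix i :: 'a assume "i \<in> Basis"
    from L2_space_continuous[OF Ck_1D(3)[OF assms this], of c d]
    show "integrable (lebesgue_on (cbox c d)) (\<lambda>x. partial_deriv i \<phi> x * partial_deriv i \<phi> x)"
      using integrable_L2_inner by fastforce
  qed
  finally show ?thesis by (simp add: L2_norm_square L2_inner_def)
qed

lemma line_mean_line:
  assumes "i \<in> Basis"
  shows "line_mean i \<alpha> \<beta> g (x + s *\<^sub>R i) = line_mean i \<alpha> \<beta> g x"
proof -
  have "x + s *\<^sub>R i + (t - (x + s *\<^sub>R i) \<bullet> i) *\<^sub>R i = x + (t - x \<bullet> i) *\<^sub>R i" for t
    using assms by (simp add: inner_add_left algebra_simps)
  then show ?thesis unfolding line_mean_def by presburger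
qed

lemma line_mean_mono:
  fixes g h :: "'a::euclidean_space \<Rightarrow> real"
  assumes "continuous_on UNIV g" "continuous_on UNIV h" "\<alpha> < \<beta>"
    and "integral {\<alpha>..\<beta>} (\<lambda>t. g (x + (t - x \<bullet> i) *\<^sub>R i)) \<le> c * integral {\<alpha>..\<beta>} (\<lambda>t. h (x + (t - x \<bullet> i) *\<^sub>R i))"
  shows "line_mean i \<alpha> \<beta> g x \<le> c * line_mean i \<alpha> \<beta> h x"
  using divide_right_mono[OF assms(4), of "\<beta> - \<alpha>"] assms(3) by (simp add: line_mean_def)

text \<open>Both sides are averaged over the lines parallel to \<open>i\<close>. The averages are
  ordered pointwise and have the same integrals over the box as the functions themselves.\<close>

lemma integral_cbox_le_of_lines:
  fixes g h :: "'a::euclidean_space \<Rightarrow> real"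
  assumes cd: "\<And>j. j \<in> Basis \<Longrightarrow> c \<bullet> j < d \<bullet> j" and i: "i \<in> Basis"
    and g: "continuous_on UNIV g" "\<And>x. 0 \<le> g x" and h: "continuous_on UNIV h" "\<And>x. 0 \<le> h x"
    and le: "\<And>x. integral {c \<bullet> i..d \<bullet> i} (\<lambda>t. g (x + (t - x \<bullet> i) *\<^sub>R i))
               \<le> C * integral {c \<bullet> i..d \<bullet> i} (\<lambda>t. h (x + (t - x \<bullet> i) *\<^sub>R i))"
  shows "integral (cbox c d) g \<le> C * integral (cbox c d) h"
proof -
  let ?M = "line_mean i (c \<bullet> i) (d \<bullet> i)"
  have "integral (cbox c d) (?M g) \<le> integral (cbox c d) (\<lambda>x. C * ?M h x)"
    using line_mean_mono[OF g(1) h(1) cd[OF i] le]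
    by (intro integral_le integrable_continuous continuous_intros
        continuous_on_subset[OF continuous_on_line_mean[OF g(1)]]
        continuous_on_subset[OF continuous_on_line_mean[OF h(1)]]) auto
  then show ?thesis
    using integral_cbox_line_mean[OF cd i g] integral_cbox_line_mean[OF cd i h] by simp
qed

text \<open>On each line the squared mean is at most the mean of the squares, and taking means along
  lines leaves the integral over the box unchanged.\<close>

lemma L2_norm_line_mean_le:
  fixes g :: "'a::euclidean_space \<Rightarrow> real"
  assumes cd: "\<And>j. j \<in> Basis \<Longrightarrow> c \<bullet> j < d \<bullet> j" and i: "i \<in> Basis"
    and g: "continuous_on UNIV g"
  shows "L2_norm (cbox c d) (line_mean i (c \<bullet> i) (d \<bullet> i) g) \<le> L2_norm (cbox c d) g"
proof (rule power2_le_imp_le)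
  let ?M = "line_mean i (c \<bullet> i) (d \<bullet> i)"
  note Mg = continuous_on_line_mean[OF g, of i "c \<bullet> i" "d \<bullet> i"]
  have g2: "continuous_on UNIV (\<lambda>x. (g x)\<^sup>2)" by (intro continuous_intros g)
  have "integral (cbox c d) (\<lambda>x. (?M g x)\<^sup>2) \<le> integral (cbox c d) (?M (\<lambda>x. (g x)\<^sup>2))"
  proof (intro integral_le integrable_continuous)
    show "continuous_on (cbox c d) (\<lambda>x. (?M g x)\<^sup>2)"
      by (intro continuous_intros continuous_on_subset[OF Mg]) simp
    show "continuous_on (cbox c d) (?M (\<lambda>x. (g x)\<^sup>2))"
      by (rule continuous_on_subset[OF continuous_on_line_mean[OF g2]]) simp
    show "(?M g x)\<^sup>2 \<le> ?M (\<lambda>x. (g x)\<^sup>2) x" for x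
      unfolding line_mean_def by (rule integral_square_mean_le[OF cd[OF i] continuous_on_line[OF g]])
  qed
  then show "(L2_norm (cbox c d) (?M g))\<^sup>2 \<le> (L2_norm (cbox c d) g)\<^sup>2"
    using integral_cbox_line_mean[OF cd i g2] by (simp add: L2_norm_continuous g Mg)
qed (rule L2_norm_nonneg)

text \<open>Along a line parallel to \<open>i\<close> the mean is a constant, so the Neumann
  inequality on an interval applies, with the same constant on every line.\<close>

lemma L2_norm_minus_line_mean_le:
  fixes \<phi> :: "'a::euclidean_space \<Rightarrow> real"
  assumes cd: "\<And>j. j \<in> Basis \<Longrightarrow> c \<bullet> j < d \<bullet> j" and i: "i \<in> Basis"
    and \<phi>: "Ck (Suc 0) \<phi>"
  shows "L2_norm (cbox c d) (\<lambda>x. \<phi> x - line_mean i (c \<bullet> i) (d \<bullet> i) \<phi> x)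
    \<le> (d \<bullet> i - c \<bullet> i) / pi * L2_norm (cbox c d) (partial_deriv i \<phi>)"
proof (rule power2_le_imp_le)
  let ?M = "line_mean i (c \<bullet> i) (d \<bullet> i)"
  note \<phi>c = Ck_1D(1)[OF \<phi>] and \<phi>' = Ck_1D(3)[OF \<phi> i]
  have c1: "continuous_on UNIV (\<lambda>x. \<phi> x - ?M \<phi> x)"
    by (intro continuous_intros \<phi>c continuous_on_line_mean)
  have "integral (cbox c d) (\<lambda>x. (\<phi> x - ?M \<phi> x)\<^sup>2)
      \<le> ((d \<bullet> i - c \<bullet> i) / pi)\<^sup>2 * integral (cbox c d) (\<lambda>x. (partial_deriv i \<phi> x)\<^sup>2)"
  proof (rule integral_cbox_le_of_lines[OF cd i])
    fix x
    show "integral {c \<bullet> i..d \<bullet> i} (\<lambda>t. (\<phi> (x + (t - x \<bullet> i) *\<^sub>R i) - ?M \<phi> (x + (t - x \<bullet> i) *\<^sub>R i))\<^sup>2)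
      \<le> ((d \<bullet> i - c \<bullet> i) / pi)\<^sup>2 * integral {c \<bullet> i..d \<bullet> i} (\<lambda>t. (partial_deriv i \<phi> (x + (t - x \<bullet> i) *\<^sub>R i))\<^sup>2)"
      using neumann_poincare_1d[OF cd[OF i] has_field_derivative_line[OF \<phi>] continuous_on_line[OF \<phi>'], of x "x \<bullet> i"]
      by (simp add: line_mean_line[OF i]) (simp add: line_mean_def)
  qed (auto intro!: continuous_intros c1 \<phi>')
  then show "(L2_norm (cbox c d) (\<lambda>x. \<phi> x - ?M \<phi> x))\<^sup>2 \<le> ((d \<bullet> i - c \<bullet> i) / pi * L2_norm (cbox c d) (partial_deriv i \<phi>))\<^sup>2"
    unfolding power_mult_distrib L2_norm_continuous[OF c1] L2_norm_continuous[OF \<phi>'] .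
  show "0 \<le> (d \<bullet> i - c \<bullet> i) / pi * L2_norm (cbox c d) (partial_deriv i \<phi>)"
    using cd[OF i] by (simp add: L2_norm_nonneg)
qed

text \<open>\<open>\<psi>\<close> is obtained by averaging over the directions in \<open>J\<close> one after the other; each averaging
  is an \<open>L\<^sup>2\<close> contraction, so the one-dimensional errors just add up.\<close>

lemma partial_average:
  fixes \<phi> :: "'a::euclidean_space \<Rightarrow> real"
  assumes cd: "\<And>j. j \<in> Basis \<Longrightarrow> c \<bullet> j < d \<bullet> j" and \<phi>: "Ck (Suc 0) \<phi>"
    and "finite J" "J \<subseteq> Basis"
  shows "\<exists>\<psi>. continuous_on UNIV \<psi> \<and> (\<forall>j\<in>J. \<forall>x t. \<psi> (x + t *\<^sub>R j) = \<psi> x) \<and>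
    L2_norm (cbox c d) (\<lambda>x. \<phi> x - \<psi> x)
      \<le> (\<Sum>j\<in>J. (d \<bullet> j - c \<bullet> j) / pi * L2_norm (cbox c d) (partial_deriv j \<phi>))"
  using assms(3,4)
proof (induction J rule: finite_induct)
  case empty
  show ?case using Ck_1D(1)[OF \<phi>] by (intro exI[of _ \<phi>]) (simp add: L2_norm_def L2_inner_def)
next
  case (insert i J)
  then obtain \<psi> where \<psi>: "continuous_on UNIV \<psi>" and inv: "\<And>j x t. j \<in> J \<Longrightarrow> \<psi> (x + t *\<^sub>R j) = \<psi> x"
    and le: "L2_norm (cbox c d) (\<lambda>x. \<phi> x - \<psi> x)
      \<le> (\<Sum>j\<in>J. (d \<bullet> j - c \<bullet> j) / pi * L2_norm (cbox c d) (partial_deriv j \<phi>))"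
    by auto
  let ?M = "line_mean i (c \<bullet> i) (d \<bullet> i)"
  have i: "i \<in> Basis" and J: "J \<subseteq> Basis" using insert.prems by auto
  note \<phi>c = Ck_1D(1)[OF \<phi>]
  have c1: "continuous_on UNIV (\<lambda>x. \<phi> x - ?M \<phi> x)"
    by (intro continuous_intros \<phi>c continuous_on_line_mean)
  have c2: "continuous_on UNIV (\<lambda>x. \<phi> x - \<psi> x)" by (intro continuous_intros \<phi>c \<psi>)
  \<comment> \<open>The error is split as (\<phi> - M \<phi>) + M (\<phi> - \<psi>), where M
    averages in direction \<open>i\<close>: the first part is a one-dimensional error, the second a
    contraction of the error made so far.\<close>
  have "L2_norm (cbox c d) (\<lambda>x. \<phi> x - ?M \<psi> x)
      = L2_norm (cbox c d) (\<lambda>x. (\<phi> x - ?M \<phi> x) + ?M (\<lambda>x. \<phi> x - \<psi> x) x)"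
    by (simp add: line_mean_diff[OF \<phi>c \<psi>])
  also have "\<dots> \<le> L2_norm (cbox c d) (\<lambda>x. \<phi> x - ?M \<phi> x) + L2_norm (cbox c d) (?M (\<lambda>x. \<phi> x - \<psi> x))"
    by (intro L2_norm_triangle L2_space_continuous c1 continuous_on_line_mean c2)
  also have "\<dots> \<le> (d \<bullet> i - c \<bullet> i) / pi * L2_norm (cbox c d) (partial_deriv i \<phi>)
      + (\<Sum>j\<in>J. (d \<bullet> j - c \<bullet> j) / pi * L2_norm (cbox c d) (partial_deriv j \<phi>))"
    using L2_norm_minus_line_mean_le[OF cd i \<phi>] L2_norm_line_mean_le[OF cd i c2] le by linarith
  finally have "L2_norm (cbox c d) (\<lambda>x. \<phi> x - ?M \<psi> x)
      \<le> (\<Sum>j\<in>insert i J. (d \<bullet> j - c \<bullet> j) / pi * L2_norm (cbox c d) (partial_deriv j \<phi>))"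
    using insert.hyps by simp
  \<comment> \<open>Averaging in direction \<open>i\<close> preserves invariance in the earlier
    directions because they are orthogonal to \<open>i\<close>: a translation along \<open>j\<close>
    leaves the i-th coordinate alone and passes through the integral.\<close>
  moreover have "?M \<psi> (x + t *\<^sub>R j) = ?M \<psi> x" if j: "j \<in> insert i J" for j x t
  proof (cases "j = i")
    case True
    then show ?thesis using line_mean_line[OF i] by simp
  next
    case False
    then have "j \<in> J" "j \<bullet> i = 0" using j J i by (auto simp: inner_Basis)
    then have "\<psi> (x + t *\<^sub>R j + (s - (x + t *\<^sub>R j) \<bullet> i) *\<^sub>R i) = \<psi> (x + (s - x \<bullet> i) *\<^sub>R i)" for s
      using inv[of j "x + (s - x \<bullet> i) *\<^sub>R i" t] by (simp add: inner_add_left add_ac)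
    then show ?thesis by (simp add: line_mean_def)
  qed
  ultimately show ?case using continuous_on_line_mean[OF \<psi>] by (intro exI[of _ "?M \<psi>"]) auto
qed

text \<open>The point \<open>x\<close> is reached from the origin by one translation for each basis
  vector.\<close>

lemma constant_of_Basis_translations:
  fixes \<psi> :: "'a::euclidean_space \<Rightarrow> 'b"
  assumes "\<And>j x t. j \<in> Basis \<Longrightarrow> \<psi> (x + t *\<^sub>R j) = \<psi> x"
  shows "\<psi> x = \<psi> 0"
proof -
  have "\<psi> (\<Sum>j\<in>J. (x \<bullet> j) *\<^sub>R j) = \<psi> 0" if "finite J" "J \<subseteq> Basis" for J
    using that by (induction J rule: finite_induct) (auto simp: add.commute[of "_ *\<^sub>R _"] assms)
  from this[of Basis] show ?thesis by (simp add: euclidean_representation)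
qed

text \<open>After averaging in all directions \<open>\<psi>\<close> is constant, and
  \<open>s\<close> is orthogonal to constants, so \<open>\<phi>\<close> may be replaced by
  \<open>\<phi> - \<psi>\<close>. In this dual form the constant does not have to be identified with
  the mean value of \<open>\<phi>\<close>. The diameter arises from Cauchy-Schwarz, applied to the
  vector of side lengths and the vector of norms of the partial derivatives.\<close>

lemma box_poincare:
  fixes \<phi> s :: "'a::euclidean_space \<Rightarrow> real"
  assumes cd: "\<And>j. j \<in> Basis \<Longrightarrow> c \<bullet> j < d \<bullet> j" and \<phi>: "Ck (Suc 0) \<phi>"
    and s: "s \<in> L2_space (cbox c d)" and s0: "L2_inner (cbox c d) s (\<lambda>x. 1) = 0"
  shows "\<bar>L2_inner (cbox c d) s \<phi>\<bar>
    \<le> diameter (cbox c d) / pi * L2_norm (cbox c d) s * L2_norm (cbox c d) (grad \<phi>)"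
proof -
  let ?K = "cbox c d"
  obtain \<psi> where \<psi>: "continuous_on UNIV \<psi>" and inv: "\<And>j x t. j \<in> Basis \<Longrightarrow> \<psi> (x + t *\<^sub>R j) = \<psi> x"
    and le: "L2_norm ?K (\<lambda>x. \<phi> x - \<psi> x) \<le> (\<Sum>j\<in>Basis. (d \<bullet> j - c \<bullet> j) / pi * L2_norm ?K (partial_deriv j \<phi>))"
    using partial_average[OF cd \<phi> finite_Basis subset_refl] by blast
  have const: "\<psi> x = \<psi> 0 *\<^sub>R 1" for x
    using constant_of_Basis_translations[of \<psi> x] inv by simp
  have diam: "diameter ?K = sqrt (\<Sum>j\<in>Basis. (d \<bullet> j - c \<bullet> j)\<^sup>2)"
    using cd by (subst diameter_cbox) (auto simp: less_imp_le dist_commute[of c] euclidean_dist_l2[of d] L2_set_def dist_real_def)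
  have "(\<Sum>j\<in>Basis. (d \<bullet> j - c \<bullet> j) * L2_norm ?K (partial_deriv j \<phi>))\<^sup>2
      \<le> (diameter ?K * L2_norm ?K (grad \<phi>))\<^sup>2"
    using Cauchy_Schwarz_ineq_sum[of "\<lambda>j. d \<bullet> j - c \<bullet> j" "\<lambda>j. L2_norm ?K (partial_deriv j \<phi>)" Basis]
    by (simp add: power_mult_distrib L2_norm_grad[OF \<phi>] diam sum_nonneg)
  then have "(\<Sum>j\<in>Basis. (d \<bullet> j - c \<bullet> j) * L2_norm ?K (partial_deriv j \<phi>)) \<le> diameter ?K * L2_norm ?K (grad \<phi>)"
    by (rule power2_le_imp_le) (simp add: diameter_ge_0 L2_norm_nonneg)
  then have "(\<Sum>j\<in>Basis. (d \<bullet> j - c \<bullet> j) * L2_norm ?K (partial_deriv j \<phi>)) / pi \<le> diameter ?K * L2_norm ?K (grad \<phi>) / pi"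
    by (rule divide_right_mono) simp
  with le have le': "L2_norm ?K (\<lambda>x. \<phi> x - \<psi> x) \<le> diameter ?K / pi * L2_norm ?K (grad \<phi>)"
    by (simp add: sum_divide_distrib)
  have \<phi>2: "\<phi> \<in> L2_space ?K" and \<psi>2: "\<psi> \<in> L2_space ?K"
    by (auto intro!: L2_space_continuous Ck_1D(1)[OF \<phi>] \<psi>)
  have "L2_inner ?K s \<psi> = 0"
    using s0 L2_inner_scaleR_right[of ?K s "\<psi> 0" "\<lambda>x. 1::real"] const by (metis ext mult_zero_right)
  then have "\<bar>L2_inner ?K s \<phi>\<bar> = \<bar>L2_inner ?K s (\<lambda>x. \<phi> x - \<psi> x)\<bar>"
    by (simp add: L2_inner_diff_right[OF \<phi>2 \<psi>2 s])
  also have "\<dots> \<le> L2_norm ?K s * L2_norm ?K (\<lambda>x. \<phi> x - \<psi> x)"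
    by (rule L2_Cauchy_Schwarz[OF s L2_space_diff[OF \<phi>2 \<psi>2]])
  also have "\<dots> \<le> L2_norm ?K s * (diameter ?K / pi * L2_norm ?K (grad \<phi>))"
    by (rule mult_left_mono[OF le' L2_norm_nonneg])
  finally show ?thesis by (simp add: mult_ac)
qed

lemma C_P_pos:
  assumes "\<And>j. j \<in> Basis \<Longrightarrow> a \<bullet> j < b \<bullet> j"
  shows "0 < C_P a b"
proof -
  have "0 < (\<Sum>i\<in>Basis. inverse ((b \<bullet> i - a \<bullet> i)\<^sup>2))"
    using assms by (intro sum_pos) force+
  then show ?thesis by (simp add: C_P_def)
qed

text \<open>The Dirichlet inequality on the lines parallel to each \<open>i\<close> bounds the same
  quantity, the norm of \<open>\<phi>\<close>, by a different part of the gradient. Adding these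
  bounds over all directions yields the sum of inverse squared side lengths in
  \<open>C_P\<close>.\<close>

lemma box_friedrichs:
  fixes \<phi> :: "'a::euclidean_space \<Rightarrow> real"
  assumes ab: "\<And>j. j \<in> Basis \<Longrightarrow> a \<bullet> j < b \<bullet> j" and \<phi>: "Ck (Suc 0) \<phi>"
    and z: "\<And>x. x \<notin> box a b \<Longrightarrow> \<phi> x = 0"
  shows "L2_norm (cbox a b) \<phi> \<le> C_P a b * L2_norm (cbox a b) (grad \<phi>)"
proof -
  let ?K = "cbox a b"
  define s where "s = (\<Sum>i\<in>Basis. inverse ((b \<bullet> i - a \<bullet> i)\<^sup>2))"
  have s: "0 < s" unfolding s_def using ab by (intro sum_pos) force+
  have dir: "pi\<^sup>2 * inverse ((b \<bullet> i - a \<bullet> i)\<^sup>2) * (L2_norm ?K \<phi>)\<^sup>2 \<le> (L2_norm ?K (partial_deriv i \<phi>))\<^sup>2"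
    if i: "i \<in> Basis" for i
  proof -
    note \<phi>c = Ck_1D(1)[OF \<phi>] and \<phi>' = Ck_1D(3)[OF \<phi> i]
    have "integral ?K (\<lambda>x. (\<phi> x)\<^sup>2) \<le> ((b \<bullet> i - a \<bullet> i) / pi)\<^sup>2 * integral ?K (\<lambda>x. (partial_deriv i \<phi> x)\<^sup>2)"
    proof (rule integral_cbox_le_of_lines[OF ab i])
      fix x
      \<comment> \<open>These end points have i-th coordinate \<open>a \<bullet> i\<close> or
        \<open>b \<bullet> i\<close> and thus lie outside the open box, whichever line is
        considered.\<close>
      have bd: "\<phi> (x + (a \<bullet> i - x \<bullet> i) *\<^sub>R i) = 0" "\<phi> (x + (b \<bullet> i - x \<bullet> i) *\<^sub>R i) = 0"
        using i by (auto intro!: z simp: mem_box inner_add_left dest!: bspec[of _ _ i])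
      show "integral {a \<bullet> i..b \<bullet> i} (\<lambda>t. (\<phi> (x + (t - x \<bullet> i) *\<^sub>R i))\<^sup>2)
        \<le> ((b \<bullet> i - a \<bullet> i) / pi)\<^sup>2 * integral {a \<bullet> i..b \<bullet> i} (\<lambda>t. (partial_deriv i \<phi> (x + (t - x \<bullet> i) *\<^sub>R i))\<^sup>2)"
        using dirichlet_poincare_1d[OF ab[OF i] has_field_derivative_line[OF \<phi>] continuous_on_line[OF \<phi>'] bd] ab[OF i]
        by (simp add: field_simps)
    qed (auto intro!: continuous_intros \<phi>c \<phi>')
    then show ?thesis using ab[OF i] by (simp add: L2_norm_continuous \<phi>c \<phi>' field_simps)
  qed
  have "pi\<^sup>2 * s * (L2_norm ?K \<phi>)\<^sup>2 = (\<Sum>i\<in>Basis. pi\<^sup>2 * inverse ((b \<bullet> i - a \<bullet> i)\<^sup>2) * (L2_norm ?K \<phi>)\<^sup>2)"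
    by (simp add: s_def sum_distrib_left sum_distrib_right)
  also have "\<dots> \<le> (L2_norm ?K (grad \<phi>))\<^sup>2"
    unfolding L2_norm_grad[OF \<phi>] by (intro sum_mono dir)
  finally have "(L2_norm ?K \<phi>)\<^sup>2 \<le> (L2_norm ?K (grad \<phi>))\<^sup>2 / (pi\<^sup>2 * s)"
    using s by (simp add: field_simps)
  also have "\<dots> = (C_P a b * L2_norm ?K (grad \<phi>))\<^sup>2"
  proof -
    have p: "(s powr (- 1 / 2))\<^sup>2 = inverse s"
      using s by (simp add: powr_minus powr_half_sqrt power_inverse)
    have "(C_P a b)\<^sup>2 = inverse (pi\<^sup>2 * s)"
      unfolding C_P_def s_def[symmetric] power_mult_distrib p by (simp add: power_inverse)
    then show ?thesis
      unfolding power_mult_distrib by (simp add: divide_inverse)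
  qed
  finally show ?thesis
    by (rule power2_le_imp_le) (use C_P_pos[of a b] ab in \<open>simp add: L2_norm_nonneg\<close>)
qed

section \<open>Test functions and uniqueness of weak gradients\<close>

text \<open>Lowering the order is what the product rule requires: the derivative of a product still
  contains the undifferentiated factors.\<close>

lemma Ck_Suc_imp_Ck: "Ck (Suc k) f \<Longrightarrow> Ck k f"
proof (induction k arbitrary: f)
  case 0
  then show ?case using Ck_1D(1) by simp
next
  case (Suc k)
  then show ?case by (subst Ck.simps) (metis Ck.simps(2))
qed

lemma partial_deriv_eqI:
  assumes "\<And>x. (f has_derivative f' x) (at x)"
  shows "partial_deriv i f = (\<lambda>x. f' x i)"
  using frechet_derivative_at[OF assms] by (auto simp: partial_deriv_def)

lemma Ck_const: "Ck k (\<lambda>x::'a::euclidean_space. c :: real)"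
proof (induction k arbitrary: c)
  case (Suc k)
  have "partial_deriv i (\<lambda>x::'a. c) = (\<lambda>x. 0)" for i
    by (rule partial_deriv_eqI) simp
  then show ?case using Suc by simp
qed simp

lemma Ck_has_derivative:
  "Ck (Suc k) f \<Longrightarrow> (f has_derivative frechet_derivative f (at x)) (at x)"
  by (simp add: frechet_derivative_works[symmetric])

lemma partial_deriv_add:
  assumes "Ck (Suc k) f" "Ck (Suc k) g"
  shows "partial_deriv i (\<lambda>x. f x + g x) = (\<lambda>x. partial_deriv i f x + partial_deriv i g x)"
  unfolding partial_deriv_def[of i f] partial_deriv_def[of i g]
  by (rule partial_deriv_eqI) (intro has_derivative_add Ck_has_derivative[OF assms(1)] Ck_has_derivative[OF assms(2)])

lemma partial_deriv_diff:
  assumes "Ck (Suc k) f" "Ck (Suc k) g"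
  shows "partial_deriv i (\<lambda>x. f x - g x) = (\<lambda>x. partial_deriv i f x - partial_deriv i g x)"
  unfolding partial_deriv_def[of i f] partial_deriv_def[of i g]
  by (rule partial_deriv_eqI) (intro has_derivative_diff Ck_has_derivative[OF assms(1)] Ck_has_derivative[OF assms(2)])

lemma partial_deriv_mult:
  assumes "Ck (Suc k) f" "Ck (Suc k) g"
  shows "partial_deriv i (\<lambda>x. f x * g x) = (\<lambda>x. f x * partial_deriv i g x + partial_deriv i f x * g x)"
  unfolding partial_deriv_def[of i f] partial_deriv_def[of i g]
  by (rule partial_deriv_eqI) (intro has_derivative_mult Ck_has_derivative[OF assms(1)] Ck_has_derivative[OF assms(2)])

lemma Ck_add: "Ck k f \<Longrightarrow> Ck k g \<Longrightarrow> Ck k (\<lambda>x. f x + g x)"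
proof (induction k arbitrary: f g)
  case 0
  then show ?case by (auto intro: continuous_on_add)
next
  case (Suc k)
  then show ?case by (simp add: partial_deriv_add[OF Suc.prems])
qed

lemma Ck_diff: "Ck k f \<Longrightarrow> Ck k g \<Longrightarrow> Ck k (\<lambda>x. f x - g x)"
proof (induction k arbitrary: f g)
  case 0
  then show ?case by (auto intro: continuous_on_diff)
next
  case (Suc k)
  then show ?case by (simp add: partial_deriv_diff[OF Suc.prems])
qed

lemma Ck_mult: "Ck k f \<Longrightarrow> Ck k g \<Longrightarrow> Ck k (\<lambda>x. f x * g x)"
proof (induction k arbitrary: f g)
  case 0
  then show ?case by (auto intro: continuous_on_mult)
next
  case (Suc k)
  note Ck_Suc_imp_Ck[OF Suc.prems(1)] Ck_Suc_imp_Ck[OF Suc.prems(2)]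
  with Suc show ?case by (simp add: partial_deriv_mult[OF Suc.prems] Ck_add)
qed

lemma Ck_prod:
  "finite A \<Longrightarrow> (\<And>i. i \<in> A \<Longrightarrow> Ck k (f i)) \<Longrightarrow> Ck k (\<lambda>x. \<Prod>i\<in>A. f i x)"
  by (induction A rule: finite_induct) (auto intro: Ck_const Ck_mult)

text \<open>The class of these functions is closed under differentiation, which makes them smooth at \<open>0\<close>.\<close>

definition bump :: "real poly \<Rightarrow> real \<Rightarrow> real" where
  "bump p t = (if 0 < t then poly p (inverse t) * exp (- inverse t) else 0)"

lemma tendsto_poly_exp_0: "((\<lambda>x. poly p x * exp (- x)) \<longlongrightarrow> (0::real)) at_top"
proof -
  have "((\<lambda>x. \<Sum>i\<le>degree p. coeff p i * (x ^ i / exp x)) \<longlongrightarrow> (\<Sum>i\<le>degree p. coeff p i * 0)) at_top"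
    by (intro tendsto_intros tendsto_power_div_exp_0)
  then show ?thesis
    by (simp add: poly_altdef sum_distrib_right exp_minus divide_inverse mult.assoc)
qed

lemma tendsto_bump_0: "(bump p \<longlongrightarrow> 0) (at 0)"
proof (rule filterlim_split_at)
  show "(bump p \<longlongrightarrow> 0) (at_left 0)"
    by (rule tendsto_eventually) (auto simp: bump_def eventually_at_filter)
  have "((\<lambda>t. poly p (inverse t) * exp (- inverse t)) \<longlongrightarrow> 0) (at_right 0)"
    by (rule filterlim_compose[OF tendsto_poly_exp_0 filterlim_inverse_at_top_right])
  then show "(bump p \<longlongrightarrow> 0) (at_right 0)"
    by (rule Lim_transform_eventually) (auto simp: bump_def eventually_at_filter)
qed

text \<open>With s = 1/t the derivative of p(s) exp(-s) in t is s^2 (p(s) - p'(s)) exp(-s), and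
  \<open>monom 1 2\<close> is the factor s^2.\<close>

lemma has_field_derivative_bump:
  "(bump p has_field_derivative bump (monom 1 2 * (p - pderiv p)) t) (at t)"
proof (cases "t = 0")
  case True
  \<comment> \<open>The difference quotient at 0 is again a function of the class: dividing by
    \<open>h\<close> multiplies the polynomial by its variable.\<close>
  have "(\<lambda>h. (bump p (0 + h) - bump p 0) / h) = bump (pCons 0 p)"
    by (auto simp: bump_def divide_inverse)
  moreover have "bump (monom 1 2 * (p - pderiv p)) 0 = 0" by (simp add: bump_def)
  ultimately show ?thesis
    using tendsto_bump_0[of "pCons 0 p"] unfolding True DERIV_def by metis
next
  case False
  show ?thesis
  proof (cases "0 < t")
    case True
    have "((\<lambda>t. poly p (inverse t) * exp (- inverse t)) has_field_derivative
        bump (monom 1 2 * (p - pderiv p)) t) (at t)"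
      using True by (auto intro!: derivative_eq_intros DERIV_chain2[OF poly_DERIV]
          simp: bump_def poly_monom power2_eq_square algebra_simps)
    then show ?thesis
      by (rule has_field_derivative_transform_within_open[of _ _ _ "{0<..}"]) (use True in \<open>auto simp: bump_def\<close>)
  next
    case neg: False
    have "((\<lambda>t. 0) has_field_derivative 0) (at t)" by simp
    then show ?thesis
      using False neg
      by (simp add: bump_def)
         (rule has_field_derivative_transform_within_open[of _ _ _ "{..<0}"], auto simp: bump_def)
  qed
qed

text \<open>The induction runs over all \<open>C\<close> and \<open>p\<close> at once, since a
  partial derivative changes both: the constant picks up a factor from the affine map, and the
  polynomial is replaced as in the derivative of \<open>bump\<close>.\<close>

lemma Ck_bump:
  fixes i :: "'a::euclidean_space"
  shows "Ck k (\<lambda>x::'a. C * bump p (\<alpha> * (x \<bullet> i) + \<beta>))"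
proof (induction k arbitrary: C p)
  case 0
  have "continuous_on UNIV (bump p)"
    using has_field_derivative_bump DERIV_isCont continuous_at_imp_continuous_on by blast
  then show ?case
    by (auto intro!: continuous_intros continuous_on_compose2[of UNIV "bump p"])
next
  case (Suc k)
  let ?q = "monom 1 2 * (p - pderiv p)"
  have D: "((\<lambda>x::'a. C * bump p (\<alpha> * (x \<bullet> i) + \<beta>)) has_derivative
      (\<lambda>h. (C * (\<alpha> * (h \<bullet> i))) * bump ?q (\<alpha> * (x \<bullet> i) + \<beta>))) (at x)" for x
  proof -
    have "((\<lambda>x::'a. \<alpha> * (x \<bullet> i) + \<beta>) has_derivative (\<lambda>h. \<alpha> * (h \<bullet> i))) (at x)"
      by (auto intro!: derivative_eq_intros)
    from has_derivative_compose[OF this has_field_derivative_bump[of p, unfolded has_field_derivative_def]]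
    show ?thesis by (auto intro!: derivative_eq_intros simp: mult_ac)
  qed
  then show ?case
    using Suc by (auto simp: partial_deriv_eqI[OF D] differentiable_def)
qed

section \<open>Smooth approximations of the indicator of a box\<close>

text \<open>With the constant polynomial 1, \<open>bump\<close> is exp(-1/t) for positive t and 0
  otherwise. The shift by 1 keeps the support at distance at least 1/(n+1) from every face, hence
  compact inside the open box; the factor \<open>Suc n\<close> drives the interior values to
  1.\<close>

definition box_bump :: "'a::euclidean_space \<Rightarrow> 'a \<Rightarrow> nat \<Rightarrow> 'a \<Rightarrow> real" where
  "box_bump c d n x = (\<Prod>i\<in>Basis. bump 1 (real (Suc n) * (x \<bullet> i - c \<bullet> i) - 1) * bump 1 (real (Suc n) * (d \<bullet> i - x \<bullet> i) - 1))"

lemma bump_1_bounds: "0 \<le> bump 1 t" "bump 1 t \<le> 1"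
  by (auto simp: bump_def)

lemma box_bump_bounds: "0 \<le> box_bump c d n x" "box_bump c d n x \<le> 1"
  unfolding box_bump_def
  by (auto intro!: prod_nonneg prod_le_1 mult_le_one bump_1_bounds mult_nonneg_nonneg)

lemma test_functions_box_bump:
  fixes c d :: "'a::euclidean_space"
  assumes "box c d \<subseteq> \<Omega>"
  shows "box_bump c d n \<in> test_functions \<Omega>"
proof -
  have "Ck k (box_bump c d n)" for k
  proof -
    have "Ck k (\<lambda>x::'a. bump 1 (real (Suc n) * (x \<bullet> i - c \<bullet> i) - 1))" for i
      using Ck_bump[of k 1 1 "real (Suc n)" i "- real (Suc n) * (c \<bullet> i) - 1"] by (simp add: algebra_simps)
    moreover have "Ck k (\<lambda>x::'a. bump 1 (real (Suc n) * (d \<bullet> i - x \<bullet> i) - 1))" for i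
      using Ck_bump[of k 1 1 "- real (Suc n)" i "real (Suc n) * (d \<bullet> i) - 1"] by (simp add: algebra_simps)
    ultimately show ?thesis
      unfolding box_bump_def[abs_def] by (intro Ck_prod Ck_mult) auto
  qed
  moreover
  define e where "e = (1 / real (Suc n)) *\<^sub>R (One :: 'a)"
  have sub: "closure {x. box_bump c d n x \<noteq> 0} \<subseteq> cbox (c + e) (d - e)"
  proof (rule closure_minimal[OF subsetI closed_cbox])
    fix x assume "x \<in> {x. box_bump c d n x \<noteq> 0}"
    then have "1 < real (Suc n) * (x \<bullet> i - c \<bullet> i) \<and> 1 < real (Suc n) * (d \<bullet> i - x \<bullet> i)" if "i \<in> Basis" for i
      using that unfolding box_bump_def bump_def by (fastforce split: if_splits)
    then have "1 / real (Suc n) < x \<bullet> i - c \<bullet> i \<and> 1 / real (Suc n) < d \<bullet> i - x \<bullet> i" if "i \<in> Basis" for i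
      using that by (simp add: divide_less_eq mult.commute)
    then show "x \<in> cbox (c + e) (d - e)"
      unfolding mem_box e_def by (force simp: inner_add_left inner_diff_left)
  qed
  have "cbox (c + e) (d - e) \<subseteq> box c d"
  proof
    fix x assume x: "x \<in> cbox (c + e) (d - e)"
    show "x \<in> box c d" unfolding mem_box
    proof
      fix i :: 'a assume i: "i \<in> Basis"
      have "c \<bullet> i + 1 / real (Suc n) \<le> x \<bullet> i" "x \<bullet> i \<le> d \<bullet> i - 1 / real (Suc n)"
        using x i unfolding mem_box e_def by (auto simp: inner_add_left inner_diff_left)
      moreover have "0 < 1 / real (Suc n)" by simp
      ultimately show "c \<bullet> i < x \<bullet> i \<and> x \<bullet> i < d \<bullet> i" by linarith
    qed
  qed
  with sub assms have "closure {x. box_bump c d n x \<noteq> 0} \<subseteq> \<Omega>" by blast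
  moreover have "compact (closure {x. box_bump c d n x \<noteq> 0})"
    using sub bounded_subset[OF bounded_cbox sub] by (simp add: compact_eq_bounded_closed)
  ultimately show ?thesis by (simp add: test_functions_def)
qed

lemma tendsto_box_bump: "(\<lambda>n. box_bump c d n x) \<longlonglongrightarrow> indicator (box c d) x"
proof (cases "x \<in> box c d")
  case True
  have "(\<lambda>n. bump 1 (real (Suc n) * s - 1)) \<longlonglongrightarrow> 1" if s: "0 < s" for s
  proof -
    have lim: "filterlim (\<lambda>n. real (Suc n) * s - 1) at_top sequentially"
      using s by real_asymp
    then have "(\<lambda>n. exp (- inverse (real (Suc n) * s - 1))) \<longlonglongrightarrow> exp (- 0)"
      by (intro tendsto_intros tendsto_inverse_0_at_top)
    moreover have "eventually (\<lambda>n. 0 < real (Suc n) * s - 1) sequentially"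
      using lim unfolding filterlim_at_top_dense by blast
    then have "eventually (\<lambda>n. exp (- inverse (real (Suc n) * s - 1)) = bump 1 (real (Suc n) * s - 1)) sequentially"
      by eventually_elim (simp add: bump_def)
    ultimately show ?thesis by (simp add: Lim_transform_eventually)
  qed
  then have "(\<lambda>n. box_bump c d n x) \<longlonglongrightarrow> (\<Prod>i\<in>(Basis::'a set). 1 * 1)"
    unfolding box_bump_def using True by (intro tendsto_prod tendsto_mult) (auto simp: mem_box)
  then show ?thesis using True by simp
next
  case False
  then obtain i where i: "i \<in> Basis" "x \<bullet> i \<le> c \<bullet> i \<or> d \<bullet> i \<le> x \<bullet> i"
    by (auto simp: mem_box not_less)
  have "bump 1 (real (Suc n) * s - 1) = 0" if "s \<le> 0" for s n
    using mult_nonneg_nonpos[of "real (Suc n)" s] that by (simp add: bump_def)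
  then have "box_bump c d n x = 0" for n
    unfolding box_bump_def using i by (intro prod_zero bexI[of _ i]) auto
  then show ?thesis using False by simp
qed

section \<open>Fundamental lemma of the calculus of variations\<close>

text \<open>Lebesgue differentiation: at almost every point \<open>h\<close> is the limit of its
  averages over cubes having that point as a corner, and all these averages are zero.\<close>

lemma AE_zero_of_box_integrals:
  fixes h :: "'a::euclidean_space \<Rightarrow> real"
  assumes h: "h integrable_on UNIV" and 0: "\<And>c d. integral (cbox c d) h = 0"
  shows "AE x in lebesgue. h x = 0"
proof -
  have "h integrable_on cbox c d" for c d
    using integrable_on_subcbox[OF h] by simp
  then obtain N where N: "negligible N"
    and lim: "\<And>x e. \<lbrakk>x \<notin> N; 0 < e\<rbrakk> \<Longrightarrow> \<exists>\<delta>>0. \<forall>t. 0 < t \<and> t < \<delta> \<longrightarrow>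
        norm (integral (cbox x (x + t *\<^sub>R One)) h /\<^sub>R t ^ DIM('a) - h x) < e"
    using integrable_ccontinuous_explicit[of h] by metis
  have "h x = 0" if xN: "x \<notin> N" for x
  proof (rule ccontr)
    assume "h x \<noteq> 0"
    then obtain \<delta> where \<delta>: "\<delta> > 0" "\<forall>t. 0 < t \<and> t < \<delta> \<longrightarrow>
        norm (integral (cbox x (x + t *\<^sub>R One)) h /\<^sub>R t ^ DIM('a) - h x) < \<bar>h x\<bar>"
      using lim[OF xN, of "\<bar>h x\<bar>"] by (metis zero_less_abs_iff)
    then show False using \<delta>(2)[rule_format, of "\<delta> / 2"] by (simp add: 0)
  qed
  moreover have "AE x in lebesgue. x \<notin> N"
    using N by (intro AE_not_in) (simp add: negligible_iff_null_sets)
  ultimately show ?thesis by auto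
qed

text \<open>The functions \<open>box_bump\<close> take values in [0,1] and converge to the indicator
  of a box. Dominated convergence with majorant \<open>norm (g x)\<close> therefore shows that the
  integral of \<open>g\<close> over every box inside the domain vanishes. Integrability of
  \<open>g\<close> itself comes from the finite measure of the domain.\<close>

lemma AE_zero_of_orthogonal_test_functions:
  fixes g :: "'a::euclidean_space \<Rightarrow> real"
  assumes g: "g \<in> L2_space (box a b)"
    and orth: "\<And>\<phi>. \<phi> \<in> test_functions (box a b) \<Longrightarrow> L2_inner (box a b) g \<phi> = 0"
  shows "AE x in lebesgue_on (box a b). g x = 0"
proof -
  let ?\<Omega> = "box a b"
  have one: "(\<lambda>x. 1::real) \<in> L2_space ?\<Omega>"
    by (rule L2_space_subset[OF _ _ _ L2_space_continuous[of _ a b]]) (auto simp: box_subset_cbox Diff_eq_empty_iff[THEN iffD2])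
  have gi: "integrable (lebesgue_on ?\<Omega>) g"
    using integrable_L2_inner[OF g one] by simp
  have sub0: "integral (box c d) g = 0" if cd: "box c d \<subseteq> ?\<Omega>" for c d
  proof -
    have "(\<lambda>n. LINT x|lebesgue_on ?\<Omega>. g x * box_bump c d n x) \<longlonglongrightarrow> (LINT x|lebesgue_on ?\<Omega>. g x * indicator (box c d) x)"
    proof (rule integral_dominated_convergence[where w="\<lambda>x. norm (g x)"])
      show "(\<lambda>x. g x * indicator (box c d) x) \<in> borel_measurable (lebesgue_on ?\<Omega>)"
        using cd by (intro borel_measurable_times borel_measurable_indicator borel_measurable_integrable[OF gi])
          (auto simp: sets_restrict_space_iff)
      show "(\<lambda>x. g x * box_bump c d n x) \<in> borel_measurable (lebesgue_on ?\<Omega>)" for n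
      proof -
        have "continuous_on ?\<Omega> (box_bump c d n)"
          using test_functions_box_bump[OF cd, of n] unfolding test_functions_def
          by (auto dest!: spec[of _ 0] intro: continuous_on_subset)
        then show ?thesis
          by (intro borel_measurable_times borel_measurable_integrable[OF gi] continuous_imp_measurable_on_sets_lebesgue) auto
      qed
      show "integrable (lebesgue_on ?\<Omega>) (\<lambda>x. norm (g x))" using gi by simp
      show "AE x in lebesgue_on ?\<Omega>. (\<lambda>n. g x * box_bump c d n x) \<longlonglongrightarrow> g x * indicator (box c d) x"
        by (intro AE_I2 tendsto_intros tendsto_box_bump)
      show "AE x in lebesgue_on ?\<Omega>. norm (g x * box_bump c d n x) \<le> norm (g x)" for n
        by (intro AE_I2) (simp add: abs_mult box_bump_bounds mult_left_le)
    qed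
    moreover have "(LINT x|lebesgue_on ?\<Omega>. g x * box_bump c d n x) = 0" for n
      using orth[OF test_functions_box_bump[OF cd]] by (simp add: L2_inner_def)
    ultimately have 1: "(LINT x|lebesgue_on ?\<Omega>. g x * indicator (box c d) x) = 0"
      by (simp add: LIMSEQ_const_iff)
    have "(LINT x|lebesgue_on ?\<Omega>. g x * indicator (box c d) x) = (LINT x|lebesgue_on ?\<Omega>. (if x \<in> box c d then g x else 0))"
      by (intro Bochner_Integration.integral_cong) (auto simp: indicator_def)
    also have "\<dots> = (LINT x|lebesgue_on (box c d). g x)"
      using cd by (subst Lebesgue_Measure.integral_restrict_Int) (auto simp: Int_absorb2)
    also have "\<dots> = integral (box c d) g"
    proof (rule lebesgue_integral_eq_integral)
      have "g \<in> L2_space (box c d)"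
        using cd by (intro L2_space_subset[OF _ _ _ g]) (auto simp: Diff_eq_empty_iff[THEN iffD2])
      moreover have "(\<lambda>x. 1::real) \<in> L2_space (box c d)"
        using cd by (intro L2_space_subset[OF _ _ _ one]) (auto simp: Diff_eq_empty_iff[THEN iffD2])
      ultimately show "integrable (lebesgue_on (box c d)) g" using integrable_L2_inner by fastforce
    qed simp
    finally show ?thesis using 1 by simp
  qed
  \<comment> \<open>Extension by zero admits arbitrary boxes: the intersection of one with the
    domain is again a box inside the domain.\<close>
  define h where "h x = (if x \<in> ?\<Omega> then g x else 0)" for x
  have "g integrable_on ?\<Omega>" by (rule integrable_on_lebesgue_on[OF gi]) simp
  then have "h integrable_on UNIV"
    unfolding h_def[abs_def] by (simp add: Henstock_Kurzweil_Integration.integrable_restrict_UNIV)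
  moreover have "integral (cbox c d) h = 0" for c d
  proof -
    have "integral (cbox c d) h = integral (box c d) h" by (simp add: integral_open_interval)
    also have "\<dots> = integral (?\<Omega> \<inter> box c d) g"
      unfolding h_def[abs_def] by (rule Henstock_Kurzweil_Integration.integral_restrict_Int)
    also have "\<dots> = 0"
      unfolding box_Int_box by (rule sub0) (auto simp flip: box_Int_box)
    finally show ?thesis .
  qed
  ultimately have "AE x in lebesgue. h x = 0" by (rule AE_zero_of_box_integrals)
  then have "AE x in lebesgue. x \<in> ?\<Omega> \<longrightarrow> g x = 0"
    by eventually_elim (auto simp: h_def)
  then show ?thesis by (simp add: AE_restrict_space_iff)
qed

section \<open>Sobolev functions on a box\<close>

lemma negligible_diff_open_box: "K \<subseteq> cbox a b \<Longrightarrow> negligible (K - box a b)"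
  by (rule negligible_subset[OF negligible_frontier_interval[of a b]]) auto

lemma borel_measurable_open_box:
  assumes "f \<in> borel_measurable (lebesgue_on (box a b))" "K \<subseteq> cbox a b" "K \<in> sets lebesgue"
  shows "f \<in> borel_measurable (lebesgue_on K)"
  by (rule borel_measurable_lebesgue_on_subset[OF _ assms(3) negligible_diff_open_box[OF assms(2)] assms(1)]) simp

lemma L2_space_open_box:
  assumes "f \<in> L2_space (box a b)" "K \<subseteq> cbox a b" "K \<in> sets lebesgue"
  shows "f \<in> L2_space K"
  by (rule L2_space_subset[OF _ assms(3) negligible_diff_open_box[OF assms(2)] assms(1)]) simp

lemma AE_open_box:
  assumes "AE x in lebesgue_on (box a b). P x" "K \<subseteq> cbox a b" "K \<in> sets lebesgue"
  shows "AE x in lebesgue_on K. P x"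
  by (rule AE_lebesgue_on_subset[OF _ assms(3) negligible_diff_open_box[OF assms(2)] assms(1)]) simp

lemma L2_inner_open_box:
  assumes f: "f \<in> L2_space (box a b)" and g: "g \<in> L2_space (box a b)"
  shows "L2_inner (box a b) f g = L2_inner (cbox a b) f g"
proof -
  have "f \<in> L2_space (cbox a b)" "g \<in> L2_space (cbox a b)"
    using f g by (auto intro: L2_space_open_box)
  then show ?thesis
    by (simp add: L2_inner_eq_integral f g integral_open_interval)
qed

lemma L2_norm_open_box:
  "f \<in> L2_space (box a b) \<Longrightarrow> L2_norm (box a b) f = L2_norm (cbox a b) f"
  by (simp add: L2_norm_def L2_inner_open_box)

text \<open>Elements may share boundary points. Going through the gauge integral over the closed box
  gives additivity over the division directly.\<close>

lemma L2_inner_division: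
  assumes T: "T division_of cbox a b" and f: "f \<in> L2_space (box a b)" and g: "g \<in> L2_space (box a b)"
  shows "L2_inner (box a b) f g = (\<Sum>K\<in>T. L2_inner K f g)"
proof -
  have K: "K \<in> sets lebesgue" "f \<in> L2_space K" "g \<in> L2_space K" if "K \<in> T" for K
  proof -
    have sub: "K \<subseteq> cbox a b" and "\<exists>c d. K = cbox c d" using division_ofD(2,4)[OF T that] by auto
    then show s: "K \<in> sets lebesgue" by auto
    show "f \<in> L2_space K" "g \<in> L2_space K" using L2_space_open_box[OF _ sub s] f g by auto
  qed
  have fg: "f \<in> L2_space (cbox a b)" "g \<in> L2_space (cbox a b)"
    using f g by (auto intro: L2_space_open_box)
  have "(\<lambda>x. f x \<bullet> g x) integrable_on cbox a b"
    by (rule integrable_on_lebesgue_on[OF integrable_L2_inner[OF fg]]) simp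
  then have "integral (cbox a b) (\<lambda>x. f x \<bullet> g x) = (\<Sum>K\<in>T. integral K (\<lambda>x. f x \<bullet> g x))"
    by (rule integral_combine_division_topdown[OF _ T])
  then show ?thesis
    by (simp add: L2_inner_open_box[OF f g] L2_inner_eq_integral fg K)
qed

lemma L2_norm_division:
  assumes "T division_of cbox a b" "f \<in> L2_space (box a b)"
  shows "(L2_norm (box a b) f)\<^sup>2 = (\<Sum>K\<in>T. (L2_norm K f)\<^sup>2)"
  by (simp add: L2_norm_square L2_inner_division[OF assms assms(2)])

lemma L2_norm_division_elem_le:
  assumes T: "T division_of cbox a b" and f: "f \<in> L2_space (box a b)" and K: "K \<in> T"
  shows "L2_norm K f \<le> L2_norm (box a b) f"
proof (rule power2_le_imp_le)
  show "(L2_norm K f)\<^sup>2 \<le> (L2_norm (box a b) f)\<^sup>2"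
    unfolding L2_norm_division[OF T f]
    using division_ofD(1)[OF T] K by (intro member_le_sum) auto
qed (rule L2_norm_nonneg)

lemma L2_space_continuous_open_box:
  fixes f :: "'a::euclidean_space \<Rightarrow> 'b::euclidean_space"
  assumes "continuous_on UNIV f"
  shows "f \<in> L2_space (box a b)"
  by (rule L2_space_subset[OF _ _ _ L2_space_continuous[OF assms, of a b]])
     (auto simp: box_subset_cbox Diff_eq_empty_iff[THEN iffD2])

lemma test_functionsD:
  assumes "\<phi> \<in> test_functions \<Omega>"
  shows "Ck k \<phi>" "x \<notin> \<Omega> \<Longrightarrow> \<phi> x = 0"
  using assms closure_subset[of "{x. \<phi> x \<noteq> 0}"] by (auto simp: test_functions_def)

lemma test_functions_L2:
  assumes "\<phi> \<in> test_functions \<Omega>"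
  shows "\<phi> \<in> L2_space (box a b)" "grad \<phi> \<in> L2_space (box a b)"
    "i \<in> Basis \<Longrightarrow> partial_deriv i \<phi> \<in> L2_space (box a b)"
  using Ck_1D[OF test_functionsD(1)[OF assms]] continuous_on_grad[OF test_functionsD(1)[OF assms]]
  by (auto intro!: L2_space_continuous_open_box)

section \<open>Functions vanishing on the boundary: gradients, approximation, inequalities\<close>

lemma H10_spaceD:
  assumes "v \<in> H10_space \<Omega>"
  shows "v \<in> L2_space \<Omega>" "has_weak_gradient \<Omega> v (weak_grad \<Omega> v)" "weak_grad \<Omega> v \<in> L2_space \<Omega>"
proof -
  show "v \<in> L2_space \<Omega>" using assms by (simp add: H10_space_def H1_space_def)
  obtain g where g: "has_weak_gradient \<Omega> v g" using assms by (auto simp: H10_space_def H1_space_def)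
  show "has_weak_gradient \<Omega> v (weak_grad \<Omega> v)"
    unfolding weak_grad_def by (rule someI[of "has_weak_gradient \<Omega> v", OF g])
  then show "weak_grad \<Omega> v \<in> L2_space \<Omega>" by (simp add: has_weak_gradient_def)
qed

lemma has_weak_gradient_diff:
  assumes v: "v \<in> L2_space (box a b)" "has_weak_gradient (box a b) v g"
    and w: "w \<in> L2_space (box a b)" "has_weak_gradient (box a b) w h"
  shows "has_weak_gradient (box a b) (\<lambda>x. v x - w x) (\<lambda>x. g x - h x)"
  unfolding has_weak_gradient_def
proof (intro conjI ballI)
  have g: "g \<in> L2_space (box a b)" and h: "h \<in> L2_space (box a b)"
    using v w by (auto simp: has_weak_gradient_def)
  show "(\<lambda>x. g x - h x) \<in> L2_space (box a b)" by (rule L2_space_diff[OF g h])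
  fix \<phi> :: "'a \<Rightarrow> real" and i :: 'a assume \<phi>: "\<phi> \<in> test_functions (box a b)" and i: "i \<in> Basis"
  note t = test_functions_L2[OF \<phi>, where a = a and b = b]
  show "L2_inner (box a b) (\<lambda>x. v x - w x) (partial_deriv i \<phi>) = - L2_inner (box a b) (\<lambda>x. (g x - h x) \<bullet> i) \<phi>"
    using v(2) w(2) \<phi> i
    by (simp add: inner_diff_left L2_inner_diff_left[OF v(1) w(1) t(3)[OF i]]
        L2_inner_diff_left[OF L2_space_inner_const[OF g] L2_space_inner_const[OF h] t(1)] has_weak_gradient_def)
qed

text \<open>Each component of \<open>g - h\<close> is orthogonal to all test functions. Finitely
  many exceptional null sets are then combined.\<close>

lemma has_weak_gradient_unique:
  assumes g: "has_weak_gradient (box a b) v g" and h: "has_weak_gradient (box a b) v h"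
  shows "AE x in lebesgue_on (box a b). g x = h x"
proof -
  have gh: "g \<in> L2_space (box a b)" "h \<in> L2_space (box a b)"
    using g h by (auto simp: has_weak_gradient_def)
  have "AE x in lebesgue_on (box a b). (g x - h x) \<bullet> i = 0" if i: "i \<in> Basis" for i
  proof (rule AE_zero_of_orthogonal_test_functions)
    show "(\<lambda>x. (g x - h x) \<bullet> i) \<in> L2_space (box a b)"
      by (rule L2_space_inner_const[OF L2_space_diff[OF gh]])
    fix \<phi> :: "'a \<Rightarrow> real" assume \<phi>: "\<phi> \<in> test_functions (box a b)"
    note t = test_functions_L2[OF \<phi>, where a = a and b = b]
    have "L2_inner (box a b) (\<lambda>x. g x \<bullet> i) \<phi> = L2_inner (box a b) (\<lambda>x. h x \<bullet> i) \<phi>"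
      using g h \<phi> i by (auto simp: has_weak_gradient_def)
    then show "L2_inner (box a b) (\<lambda>x. (g x - h x) \<bullet> i) \<phi> = 0"
      by (simp add: inner_diff_left L2_inner_diff_left[OF L2_space_inner_const[OF gh(1)] L2_space_inner_const[OF gh(2)] t(1)])
  qed
  then have "AE x in lebesgue_on (box a b). \<forall>i\<in>Basis. (g x - h x) \<bullet> i = 0"
    by (simp add: AE_finite_all)
  then show ?thesis by eventually_elim (simp add: euclidean_eq_iff[of "_ :: 'a"] inner_diff_left)
qed

text \<open>The energy norm of the error contains the representative chosen for the difference. It
  may deviate from the difference of the chosen representatives on a null set, so only the norms are
  claimed to be equal.\<close>

lemma L2_norm_weak_grad_diff:
  assumes v: "v \<in> H10_space (box a b)" and w: "w \<in> H10_space (box a b)"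
  shows "L2_norm (box a b) (weak_grad (box a b) (\<lambda>x. v x - w x))
       = L2_norm (box a b) (\<lambda>x. weak_grad (box a b) v x - weak_grad (box a b) w x)"
proof -
  note V = H10_spaceD[OF v] and W = H10_spaceD[OF w]
  let ?D = "\<lambda>x. weak_grad (box a b) v x - weak_grad (box a b) w x"
  let ?E = "weak_grad (box a b) (\<lambda>x. v x - w x)"
  have D: "has_weak_gradient (box a b) (\<lambda>x. v x - w x) ?D"
    by (rule has_weak_gradient_diff[OF V(1,2) W(1,2)])
  have E: "has_weak_gradient (box a b) (\<lambda>x. v x - w x) ?E"
    unfolding weak_grad_def[of _ "\<lambda>x. v x - w x"]
    by (rule someI[of "has_weak_gradient (box a b) (\<lambda>x. v x - w x)", OF D])
  have "AE x in lebesgue_on (box a b). ?E x \<bullet> ?E x = ?D x \<bullet> ?D x"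
    using has_weak_gradient_unique[OF E D] by eventually_elim simp
  then have "L2_inner (box a b) ?E ?E = L2_inner (box a b) ?D ?D"
    using D E by (intro L2_inner_AE_cong) (auto simp: has_weak_gradient_def)
  then show ?thesis by (simp add: L2_norm_def)
qed

lemma grad_diff:
  assumes "Ck (Suc 0) \<phi>" "Ck (Suc 0) \<psi>"
  shows "grad (\<lambda>x. \<phi> x - \<psi> x) = (\<lambda>x. grad \<phi> x - grad \<psi> x)"
  by (simp add: grad_def[abs_def] partial_deriv_diff[OF assms] scaleR_diff_left sum_subtractf)

lemma tendsto_L2_norm_diff_diff:
  assumes v: "v \<in> L2_space S" "\<And>n. \<phi> n \<in> L2_space S" and w: "w \<in> L2_space S" "\<And>n. \<psi> n \<in> L2_space S"
    and lim: "(\<lambda>n::nat. L2_norm S (\<lambda>x. v x - \<phi> n x)) \<longlonglongrightarrow> 0" "(\<lambda>n. L2_norm S (\<lambda>x. w x - \<psi> n x)) \<longlonglongrightarrow> 0"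
  shows "(\<lambda>n. L2_norm S (\<lambda>x. (v x - w x) - (\<phi> n x - \<psi> n x))) \<longlonglongrightarrow> 0"
proof (rule Lim_null_comparison)
  have "L2_norm S (\<lambda>x. (v x - w x) - (\<phi> n x - \<psi> n x))
      \<le> L2_norm S (\<lambda>x. v x - \<phi> n x) + L2_norm S (\<lambda>x. w x - \<psi> n x)" for n
    using L2_norm_triangle[OF L2_space_diff[OF v(1) v(2)[of n]] L2_space_diff[OF w(2)[of n] w(1)]]
    by (simp add: L2_norm_minus_commute[of S "\<psi> n" w] algebra_simps)
  then show "\<forall>\<^sub>F n in sequentially. norm (L2_norm S (\<lambda>x. (v x - w x) - (\<phi> n x - \<psi> n x)))
      \<le> L2_norm S (\<lambda>x. v x - \<phi> n x) + L2_norm S (\<lambda>x. w x - \<psi> n x)"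
    by (simp add: L2_norm_nonneg)
  show "(\<lambda>n. L2_norm S (\<lambda>x. v x - \<phi> n x) + L2_norm S (\<lambda>x. w x - \<psi> n x)) \<longlonglongrightarrow> 0"
    using tendsto_add[OF lim] by simp
qed

text \<open>The difference is approximated with respect to the difference of the two chosen
  gradients; membership of \<open>v - w\<close> in \<open>H10_space\<close>, which would refer to
  yet another representative, is thereby avoided.\<close>

lemma H10_diff_approx:
  assumes v: "v \<in> H10_space (box a b)" and w: "w \<in> H10_space (box a b)"
  obtains \<xi> where "\<And>n::nat. Ck (Suc 0) (\<xi> n)" "\<And>n x. x \<notin> box a b \<Longrightarrow> \<xi> n x = 0"
    "(\<lambda>n. L2_norm (box a b) (\<lambda>x. (v x - w x) - \<xi> n x)) \<longlonglongrightarrow> 0"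
    "(\<lambda>n. L2_norm (box a b) (\<lambda>x. (weak_grad (box a b) v x - weak_grad (box a b) w x) - grad (\<xi> n) x)) \<longlonglongrightarrow> 0"
proof -
  obtain \<phi> where \<phi>: "\<And>n::nat. \<phi> n \<in> test_functions (box a b)"
    "(\<lambda>n. L2_norm (box a b) (\<lambda>x. v x - \<phi> n x)) \<longlonglongrightarrow> 0"
    "(\<lambda>n. L2_norm (box a b) (\<lambda>x. weak_grad (box a b) v x - grad (\<phi> n) x)) \<longlonglongrightarrow> 0"
    using v by (auto simp: H10_space_def)
  obtain \<psi> where \<psi>: "\<And>n::nat. \<psi> n \<in> test_functions (box a b)"
    "(\<lambda>n. L2_norm (box a b) (\<lambda>x. w x - \<psi> n x)) \<longlonglongrightarrow> 0"
    "(\<lambda>n. L2_norm (box a b) (\<lambda>x. weak_grad (box a b) w x - grad (\<psi> n) x)) \<longlonglongrightarrow> 0"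
    using w by (auto simp: H10_space_def)
  note c = test_functionsD(1)[OF \<phi>(1)] test_functionsD(1)[OF \<psi>(1)]
  show ?thesis
  proof
    show "Ck (Suc 0) (\<lambda>x. \<phi> n x - \<psi> n x)" for n by (rule Ck_diff[OF c])
    show "\<phi> n x - \<psi> n x = 0" if "x \<notin> box a b" for n x
      using test_functionsD(2)[OF \<phi>(1) that] test_functionsD(2)[OF \<psi>(1) that] by simp
    show "(\<lambda>n. L2_norm (box a b) (\<lambda>x. (v x - w x) - (\<phi> n x - \<psi> n x))) \<longlonglongrightarrow> 0"
      by (intro tendsto_L2_norm_diff_diff H10_spaceD v w test_functions_L2[OF \<phi>(1)] test_functions_L2[OF \<psi>(1)] \<phi> \<psi>)
    show "(\<lambda>n. L2_norm (box a b) (\<lambda>x. (weak_grad (box a b) v x - weak_grad (box a b) w x)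
        - grad (\<lambda>x. \<phi> n x - \<psi> n x) x)) \<longlonglongrightarrow> 0"
      unfolding grad_diff[OF c]
      by (intro tendsto_L2_norm_diff_diff H10_spaceD v w test_functions_L2[OF \<phi>(1)] test_functions_L2[OF \<psi>(1)] \<phi> \<psi>)
  qed
qed

lemma H10_friedrichs:
  assumes ab: "\<And>j. j \<in> Basis \<Longrightarrow> a \<bullet> j < b \<bullet> j"
    and v: "v \<in> H10_space (box a b)" and w: "w \<in> H10_space (box a b)"
  shows "L2_norm (box a b) (\<lambda>x. v x - w x)
    \<le> C_P a b * L2_norm (box a b) (\<lambda>x. weak_grad (box a b) v x - weak_grad (box a b) w x)"
proof -
  obtain \<xi> where \<xi>: "\<And>n::nat. Ck (Suc 0) (\<xi> n)" "\<And>n x. x \<notin> box a b \<Longrightarrow> \<xi> n x = 0"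
    and lim: "(\<lambda>n. L2_norm (box a b) (\<lambda>x. (v x - w x) - \<xi> n x)) \<longlonglongrightarrow> 0"
    "(\<lambda>n. L2_norm (box a b) (\<lambda>x. (weak_grad (box a b) v x - weak_grad (box a b) w x) - grad (\<xi> n) x)) \<longlonglongrightarrow> 0"
    by (rule H10_diff_approx[OF v w]) (rule that)
  have \<xi>2: "\<xi> n \<in> L2_space (box a b)" "grad (\<xi> n) \<in> L2_space (box a b)" for n
    by (intro L2_space_continuous_open_box Ck_1D(1)[OF \<xi>(1)] continuous_on_grad[OF \<xi>(1)])+
  have "L2_norm (box a b) (\<xi> n) \<le> C_P a b * L2_norm (box a b) (grad (\<xi> n))" for n
    using box_friedrichs[OF ab \<xi>] by (simp add: L2_norm_open_box \<xi>2)
  then show ?thesis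
    by (intro LIMSEQ_le[OF tendsto_L2_norm[OF _ _ lim(1)] tendsto_mult_left[OF tendsto_L2_norm[OF _ _ lim(2)]]]
        L2_space_diff H10_spaceD v w \<xi>2) auto
qed

text \<open>Convergence on the domain implies convergence on an element, because norms over an
  element are bounded by norms over the domain. The approximants do not in general vanish on the
  boundary of the element, which is why \<open>s\<close> has to be orthogonal to constants.\<close>

lemma H10_poincare:
  assumes T: "T division_of cbox a b" and K: "cbox c d \<in> T" and cd: "\<And>j. j \<in> Basis \<Longrightarrow> c \<bullet> j < d \<bullet> j"
    and s: "s \<in> L2_space (cbox c d)" "L2_inner (cbox c d) s (\<lambda>x. 1) = 0"
    and v: "v \<in> H10_space (box a b)" and w: "w \<in> H10_space (box a b)"
  shows "\<bar>L2_inner (cbox c d) s (\<lambda>x. v x - w x)\<bar> \<le> diameter (cbox c d) / pi * L2_norm (cbox c d) s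
    * L2_norm (cbox c d) (\<lambda>x. weak_grad (box a b) v x - weak_grad (box a b) w x)"
proof -
  let ?K = "cbox c d"
  obtain \<xi> where \<xi>: "\<And>n::nat. Ck (Suc 0) (\<xi> n)" and "\<And>n x. x \<notin> box a b \<Longrightarrow> \<xi> n x = 0"
    and lim: "(\<lambda>n. L2_norm (box a b) (\<lambda>x. (v x - w x) - \<xi> n x)) \<longlonglongrightarrow> 0"
    "(\<lambda>n. L2_norm (box a b) (\<lambda>x. (weak_grad (box a b) v x - weak_grad (box a b) w x) - grad (\<xi> n) x)) \<longlonglongrightarrow> 0"
    by (rule H10_diff_approx[OF v w]) (rule that)
  have sub: "?K \<subseteq> cbox a b" using division_ofD(2)[OF T K] .
  have \<xi>2: "\<xi> n \<in> L2_space (box a b)" "grad (\<xi> n) \<in> L2_space (box a b)"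
    "\<xi> n \<in> L2_space ?K" "grad (\<xi> n) \<in> L2_space ?K" for n
    by (intro L2_space_continuous_open_box L2_space_continuous Ck_1D(1)[OF \<xi>(1)] continuous_on_grad[OF \<xi>(1)])+
  have e: "(\<lambda>x. v x - w x) \<in> L2_space (box a b)"
    "(\<lambda>x. weak_grad (box a b) v x - weak_grad (box a b) w x) \<in> L2_space (box a b)"
    by (intro L2_space_diff H10_spaceD v w)+
  have eK: "(\<lambda>x. v x - w x) \<in> L2_space ?K"
    "(\<lambda>x. weak_grad (box a b) v x - weak_grad (box a b) w x) \<in> L2_space ?K"
    by (simp_all add: L2_space_open_box[OF e(1) sub] L2_space_open_box[OF e(2) sub])
  have limK: "(\<lambda>n. L2_norm ?K (\<lambda>x. f x - \<phi> n x)) \<longlonglongrightarrow> 0"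
    if "(\<lambda>n. L2_norm (box a b) (\<lambda>x. f x - \<phi> n x)) \<longlonglongrightarrow> 0" "f \<in> L2_space (box a b)" "\<And>n. \<phi> n \<in> L2_space (box a b)"
    for f :: "'a \<Rightarrow> 'b::euclidean_space" and \<phi> :: "nat \<Rightarrow> 'a \<Rightarrow> 'b"
    using L2_norm_division_elem_le[OF T L2_space_diff[OF that(2,3)] K]
    by (intro Lim_null_comparison[OF _ that(1)]) (simp add: L2_norm_nonneg)
  have "\<bar>L2_inner ?K s (\<xi> n)\<bar> \<le> diameter ?K / pi * L2_norm ?K s * L2_norm ?K (grad (\<xi> n))" for n
    by (rule box_poincare[OF cd \<xi> s])
  then show ?thesis
    by (intro LIMSEQ_le[OF tendsto_rabs[OF tendsto_L2_inner_right[OF s(1) eK(1) \<xi>2(3) limK[OF lim(1) e(1) \<xi>2(1)]]]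
        tendsto_mult_left[OF tendsto_L2_norm[OF eK(2) \<xi>2(4) limK[OF lim(2) e(2) \<xi>2(2)]]]]) auto
qed

text \<open>The definition of the weak divergence tests with smooth functions of compact support.
  Both sides are continuous in the norms in which these approximate \<open>v\<close>, so the formula
  survives in the limit and no boundary term appears.\<close>

lemma Hdiv_green:
  assumes \<tau>: "\<tau> \<in> Hdiv_space (box a b)" and v: "v \<in> H10_space (box a b)"
  shows "L2_inner (box a b) \<tau> (weak_grad (box a b) v) = - L2_inner (box a b) (weak_div (box a b) \<tau>) v"
    and "weak_div (box a b) \<tau> \<in> L2_space (box a b)"
proof -
  have \<tau>2: "\<tau> \<in> L2_space (box a b)" using \<tau> by (simp add: Hdiv_space_def)
  obtain q where q: "has_weak_divergence (box a b) \<tau> q" using \<tau> by (auto simp: Hdiv_space_def)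
  have q: "has_weak_divergence (box a b) \<tau> (weak_div (box a b) \<tau>)"
    unfolding weak_div_def by (rule someI[of "has_weak_divergence (box a b) \<tau>", OF q])
  then show q2: "weak_div (box a b) \<tau> \<in> L2_space (box a b)" by (simp add: has_weak_divergence_def)
  obtain \<phi> where \<phi>: "\<And>n::nat. \<phi> n \<in> test_functions (box a b)"
    "(\<lambda>n. L2_norm (box a b) (\<lambda>x. v x - \<phi> n x)) \<longlonglongrightarrow> 0"
    "(\<lambda>n. L2_norm (box a b) (\<lambda>x. weak_grad (box a b) v x - grad (\<phi> n) x)) \<longlonglongrightarrow> 0"
    using v by (auto simp: H10_space_def)
  note t = test_functions_L2[OF \<phi>(1)] and V = H10_spaceD[OF v]
  have "L2_inner (box a b) \<tau> (grad (\<phi> n)) = - L2_inner (box a b) (weak_div (box a b) \<tau>) (\<phi> n)" for n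
    using q \<phi>(1) by (simp add: has_weak_divergence_def)
  then show "L2_inner (box a b) \<tau> (weak_grad (box a b) v) = - L2_inner (box a b) (weak_div (box a b) \<tau>) v"
    using tendsto_L2_inner_right[OF \<tau>2 V(3) t(2) \<phi>(3)]
      tendsto_minus[OF tendsto_L2_inner_right[OF q2 V(1) t(1) \<phi>(2)]]
    by (simp add: LIMSEQ_unique)
qed

lemma continuous_on_Q1:
  fixes p :: "'a::euclidean_space \<Rightarrow> real"
  shows "p \<in> Q1 \<Longrightarrow> continuous_on UNIV p"
  by (auto simp: Q1_def intro!: continuous_intros)

text \<open>The choice in \<open>proj_Q1\<close> is meaningful because a projection onto the span of
  the monomials exists. The error estimate relies on two consequences: square integrability, and
  orthogonality of the remainder to constants.\<close>

lemma proj_Q1: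
  assumes g: "g \<in> L2_space (cbox c d)"
  shows "proj_Q1 (cbox c d) g \<in> L2_space (cbox c d)"
    and "L2_inner (cbox c d) (\<lambda>x. g x - proj_Q1 (cbox c d) g x) (\<lambda>x. 1) = 0"
proof -
  let ?K = "cbox c d" and ?I = "Pow (Basis :: 'a set)"
  let ?B = "\<lambda>S (x::'a). \<Prod>i\<in>S. x \<bullet> i"
  have B: "?B S \<in> L2_space ?K" for S :: "'a set"
    by (intro L2_space_continuous continuous_intros)
  obtain k where k: "\<And>S. S \<in> ?I \<Longrightarrow> L2_inner ?K (\<lambda>x. g x - (\<Sum>S\<in>?I. k S * ?B S x)) (?B S) = 0"
    using L2_projection_exists[of ?I ?B ?K g] B g by auto
  let ?p = "\<lambda>x. \<Sum>S\<in>?I. k S * ?B S x"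
  have p: "?p \<in> Q1" by (auto simp: Q1_def)
  have gp: "(\<lambda>x. g x - ?p x) \<in> L2_space ?K"
    by (rule L2_space_diff[OF g L2_space_continuous[OF continuous_on_Q1[OF p]]])
  have orth: "L2_inner ?K (\<lambda>x. g x - ?p x) q = 0" if "q \<in> Q1" for q
  proof -
    from that obtain e where q: "q = (\<lambda>x. \<Sum>S\<in>?I. e S * ?B S x)" by (auto simp: Q1_def)
    show ?thesis unfolding q
      using L2_inner_sum_right[OF B gp, where I = ?I and e = e] k by simp
  qed
  have P: "proj_Q1 ?K g \<in> Q1 \<and> (\<forall>q\<in>Q1. L2_inner ?K (\<lambda>x. g x - proj_Q1 ?K g x) q = 0)"
    unfolding proj_Q1_def by (rule someI[of _ ?p]) (use p orth in blast)
  then show "proj_Q1 ?K g \<in> L2_space ?K" by (intro L2_space_continuous continuous_on_Q1) auto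
  \<comment> \<open>The constant function is the monomial of the empty set of variables, an empty
    product.\<close>
  have "(\<lambda>x::'a. 1) = (\<lambda>x. \<Sum>S\<in>?I. (if S = {} then 1 else 0) * ?B S x)"
    by (auto simp: if_distrib[of "\<lambda>t. t * _"] cong: if_cong)
  then have "(\<lambda>x::'a. 1::real) \<in> Q1" unfolding Q1_def
    by (intro CollectI exI[of _ "\<lambda>S. if S = {} then 1 else 0"])
  then show "L2_inner ?K (\<lambda>x. g x - proj_Q1 ?K g x) (\<lambda>x. 1) = 0" using P by blast
qed

section \<open>The error estimate\<close>

lemma mult_add_mult_le_sqrt:
  fixes x y z w :: real
  shows "x * z + y * w \<le> sqrt (x\<^sup>2 + y\<^sup>2) * sqrt (z\<^sup>2 + w\<^sup>2)"
proof -
  have "0 \<le> (x * w - y * z)\<^sup>2" by simp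
  then have "(x * z + y * w)\<^sup>2 \<le> (x\<^sup>2 + y\<^sup>2) * (z\<^sup>2 + w\<^sup>2)"
    by (simp add: power2_eq_square algebra_simps)
  then show ?thesis
    by (metis real_le_rsqrt real_sqrt_mult)
qed

lemma sum_mult_le_sqrt:
  fixes x y :: "'a \<Rightarrow> real"
  shows "(\<Sum>k\<in>A. x k * y k) \<le> sqrt (\<Sum>k\<in>A. (x k)\<^sup>2) * sqrt (\<Sum>k\<in>A. (y k)\<^sup>2)"
  using Cauchy_Schwarz_ineq_sum[of x y A] by (metis real_le_rsqrt real_sqrt_mult)

lemma mesh_element:
  assumes T: "hyperrectangular_mesh T (box a b)" and ab: "box a b \<noteq> {}"
  shows "T division_of cbox a b"
    and "K \<in> T \<Longrightarrow> \<exists>c d. K = cbox c d \<and> (\<forall>j\<in>Basis. c \<bullet> j < d \<bullet> j)"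
proof -
  show d: "T division_of cbox a b"
    using T ab by (simp add: hyperrectangular_mesh_def closure_box)
  assume K: "K \<in> T"
  obtain c e where "K = cbox c e" using division_ofD(4)[OF d K] by blast
  moreover have "interior K \<noteq> {}" using T K by (simp add: hyperrectangular_mesh_def)
  ultimately show "\<exists>c d. K = cbox c d \<and> (\<forall>j\<in>Basis. c \<bullet> j < d \<bullet> j)"
    by (auto simp: box_ne_empty)
qed

lemma Linf_space_bound:
  assumes "\<kappa> \<in> Linf_space S"
  obtains M where "AE x in lebesgue_on S. \<bar>\<kappa> x\<bar> \<le> M"
proof -
  obtain M where M: "esssup (lebesgue_on S) (\<lambda>x. ereal \<bar>\<kappa> x\<bar>) \<le> ereal M"
    using assms ereal_dense2[of "esssup (lebesgue_on S) (\<lambda>x. ereal \<bar>\<kappa> x\<bar>)" \<infinity>]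
    by (auto simp: Linf_space_def intro: less_imp_le)
  have "AE x in lebesgue_on S. ereal \<bar>\<kappa> x\<bar> \<le> esssup (lebesgue_on S) (\<lambda>x. ereal \<bar>\<kappa> x\<bar>)"
    by (rule esssup_AE)
  then have "AE x in lebesgue_on S. \<bar>\<kappa> x\<bar> \<le> M"
    by eventually_elim (use M in \<open>meson ereal_less_eq(3) order_trans\<close>)
  then show ?thesis by (rule that)
qed

lemma ess_inf_pos:
  assumes "0 < ess_inf S \<kappa>"
  obtains m where "0 < m" "AE x in lebesgue_on S. m \<le> \<kappa> x"
proof -
  obtain m where m: "0 < ereal m" "ereal m < ess_inf S \<kappa>"
    using ereal_dense2[OF assms] by auto
  have "AE x in lebesgue_on S. - ereal (\<kappa> x) \<le> esssup (lebesgue_on S) (\<lambda>x. - ereal (\<kappa> x))"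
    by (rule esssup_AE)
  then have "AE x in lebesgue_on S. m \<le> \<kappa> x"
  proof eventually_elim
    case (elim x)
    then have "ess_inf S \<kappa> \<le> ereal (\<kappa> x)" unfolding ess_inf_def by (simp add: ereal_uminus_le_reorder)
    with less_le_trans[OF m(2) this] show ?case by simp
  qed
  then show ?thesis using m(1) by (intro that[of m]) auto
qed

text \<open>The same pairing is bounded in two ways: by the Poincare inequality against the gradient
  of the error, or by moving the weight \<kappa> from the remainder to the error. Each factor on the
  error side is at most the local energy norm, so the smaller bound may be taken; where the weighted
  norm counts as infinite, the first bound remains.\<close>

lemma L2_inner_osc_le:
  assumes T: "T division_of cbox a b" and K: "cbox c d \<in> T" and cd: "\<And>j. j \<in> Basis \<Longrightarrow> c \<bullet> j < d \<bullet> j"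
    and r: "r \<in> L2_space (cbox c d)"
    and v: "v \<in> H10_space (box a b)" and w: "w \<in> H10_space (box a b)"
    and ke: "(\<lambda>x. \<kappa> x * (v x - w x)) \<in> L2_space (cbox c d)"
  shows "L2_inner (cbox c d) (\<lambda>x. r x - proj_Q1 (cbox c d) r x) (\<lambda>x. v x - w x)
    \<le> osc \<kappa> r (cbox c d) * sqrt ((L2_norm (cbox c d) (\<lambda>x. weak_grad (box a b) v x - weak_grad (box a b) w x))\<^sup>2
        + (L2_norm (cbox c d) (\<lambda>x. \<kappa> x * (v x - w x)))\<^sup>2)"
    (is "?L \<le> osc \<kappa> r ?K * sqrt (?D\<^sup>2 + ?k\<^sup>2)")
proof -
  define s where "s = (\<lambda>x. r x - proj_Q1 ?K r x)"
  define z where "z = (\<lambda>x. inverse (\<kappa> x) * s x)"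
  define m where "m = diameter ?K / pi * L2_norm ?K s"
  have s2: "s \<in> L2_space ?K" unfolding s_def by (rule L2_space_diff[OF r proj_Q1(1)[OF r]])
  have sub: "?K \<subseteq> cbox a b" by (rule division_ofD(2)[OF T K])
  have e: "(\<lambda>x. v x - w x) \<in> L2_space ?K"
    by (intro L2_space_open_box[OF _ sub] L2_space_diff H10_spaceD v w) simp
  have m0: "0 \<le> m" by (simp add: m_def L2_norm_nonneg diameter_ge_0)
  have DE: "?D \<le> sqrt (?D\<^sup>2 + ?k\<^sup>2)" and kE: "?k \<le> sqrt (?D\<^sup>2 + ?k\<^sup>2)"
    by (simp_all add: real_le_rsqrt)
  have "?L \<le> m * ?D"
    using H10_poincare[OF T K cd s2 proj_Q1(2)[OF r, folded s_def] v w] by (simp add: m_def s_def)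
  also have "\<dots> \<le> m * sqrt (?D\<^sup>2 + ?k\<^sup>2)" by (rule mult_left_mono[OF DE m0])
  finally have 1: "?L \<le> m * sqrt (?D\<^sup>2 + ?k\<^sup>2)" .
  have 2: "?L \<le> L2_norm ?K z * sqrt (?D\<^sup>2 + ?k\<^sup>2)"
    if k0: "AE x in lebesgue_on ?K. \<kappa> x \<noteq> 0" and z: "z \<in> L2_space ?K"
  proof -
    have "AE x in lebesgue_on ?K. s x \<bullet> (v x - w x) = z x \<bullet> (\<kappa> x * (v x - w x))"
      using k0 by eventually_elim (simp add: z_def)
    then have "?L = L2_inner ?K z (\<lambda>x. \<kappa> x * (v x - w x))"
      unfolding s_def[symmetric] by (rule L2_inner_AE_cong[OF _ s2 e z ke])
    also have "\<dots> \<le> L2_norm ?K z * ?k" using L2_Cauchy_Schwarz[OF z ke] by simp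
    also have "\<dots> \<le> L2_norm ?K z * sqrt (?D\<^sup>2 + ?k\<^sup>2)" by (rule mult_left_mono[OF kE L2_norm_nonneg])
    finally show ?thesis .
  qed
  show ?thesis
    unfolding osc_def Let_def s_def[symmetric] z_def[symmetric] m_def[symmetric]
    using 1[folded s_def] 2[folded s_def] by (auto simp: min_def)
qed

text \<open>The bound \<open>m\<close> treats positive \<open>\<kappa>\<^sub>0\<close> and
  \<open>\<kappa>\<^sub>0 = 0\<close> uniformly. It makes the inverse weight bounded, so the
  weighted residual is square integrable and Cauchy-Schwarz applies to it.\<close>

lemma energy_error_estimate:
  fixes a b :: "'a::euclidean_space"
  assumes ab: "\<And>j. j \<in> Basis \<Longrightarrow> a \<bullet> j < b \<bullet> j"
    and mesh: "hyperrectangular_mesh T (box a b)"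
    and \<kappa>L: "\<kappa> \<in> Linf_space (box a b)"
    and f: "f \<in> L2_space (box a b)"
    and sol: "weak_solution (box a b) \<kappa> f u"
    and uh: "uh \<in> H10_space (box a b)"
    and \<tau>: "\<tau> \<in> Hdiv_space (box a b)"
    and k0: "0 \<le> \<kappa>\<^sub>0" and m: "0 < m" "AE x in lebesgue_on (box a b). m \<le> \<kappa> x + \<kappa>\<^sub>0"
  shows "energy_norm (box a b) \<kappa> (\<lambda>x. u x - uh x)
    \<le> eta (box a b) T \<kappa> \<kappa>\<^sub>0 f uh \<tau>
      + \<kappa>\<^sub>0 * C_P a b * sqrt (\<Sum>K\<in>T. (div_residual_norm (box a b) \<kappa> \<kappa>\<^sub>0 (residual \<kappa> f uh) \<tau> K)\<^sup>2)"
proof -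
  define \<Omega> where "\<Omega> = box a b"
  have u: "u \<in> H10_space \<Omega>" and uh': "uh \<in> H10_space \<Omega>" using sol uh by (auto simp: weak_solution_def \<Omega>_def)
  note U = H10_spaceD[OF u] and UH = H10_spaceD[OF uh']
  define G where "G = weak_grad \<Omega> u"
  define H where "H = weak_grad \<Omega> uh"
  define D where "D x = G x - H x" for x
  define e where "e x = u x - uh x" for x
  define r where "r = residual \<kappa> f uh"
  define q where "q = weak_div \<Omega> \<tau>"
  define \<sigma> where "\<sigma> x = \<tau> x - H x" for x
  have ne: "box a b \<noteq> {}" using ab by (simp add: box_ne_empty)
  note T = mesh_element(1)[OF mesh ne] and elem = mesh_element(2)[OF mesh ne]
  obtain M where M: "AE x in lebesgue_on \<Omega>. \<bar>\<kappa> x\<bar> \<le> M"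
    by (rule Linf_space_bound[OF \<kappa>L[folded \<Omega>_def]])
  have \<kappa>m: "\<kappa> \<in> borel_measurable (lebesgue_on \<Omega>)" using \<kappa>L by (simp add: Linf_space_def \<Omega>_def)
  have M2: "AE x in lebesgue_on \<Omega>. \<bar>(\<kappa> x)\<^sup>2\<bar> \<le> M\<^sup>2"
    using M by eventually_elim (metis abs_ge_zero abs_power2 power2_abs power_mono)
  have k2: "(\<lambda>x. (\<kappa> x)\<^sup>2 * v x) \<in> L2_space \<Omega>" if "v \<in> L2_space \<Omega>" for v
    using \<kappa>m by (intro L2_space_mult_bounded[OF that _ M2]) measurable
  have k1: "(\<lambda>x. \<kappa> x * v x) \<in> L2_space \<Omega>" if "v \<in> L2_space \<Omega>" for v
    by (rule L2_space_mult_bounded[OF that \<kappa>m M])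
  have f2: "f \<in> L2_space \<Omega>" and \<tau>2: "\<tau> \<in> L2_space \<Omega>" using f \<tau> by (auto simp: \<Omega>_def Hdiv_space_def)
  have q2: "q \<in> L2_space \<Omega>" using Hdiv_green(2)[OF \<tau> uh] by (simp add: q_def \<Omega>_def)
  have G2: "G \<in> L2_space \<Omega>" and H2: "H \<in> L2_space \<Omega>" using U UH by (auto simp: G_def H_def)
  have e2: "e \<in> L2_space \<Omega>" unfolding e_def[abs_def] by (rule L2_space_diff[OF U(1) UH(1)])
  have D2: "D \<in> L2_space \<Omega>" unfolding D_def[abs_def] by (rule L2_space_diff[OF G2 H2])
  have r2: "r \<in> L2_space \<Omega>"
    unfolding r_def residual_def[abs_def] by (rule L2_space_diff[OF f2 k2[OF UH(1)]])
  have \<sigma>2: "\<sigma> \<in> L2_space \<Omega>" unfolding \<sigma>_def[abs_def] by (rule L2_space_diff[OF \<tau>2 H2])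
  note ke2 = k1[OF e2]
  define E where "E K = sqrt ((L2_norm K D)\<^sup>2 + (L2_norm K (\<lambda>x. \<kappa> x * e x))\<^sup>2)" for K
  have energy: "energy_norm \<Omega> \<kappa> (\<lambda>x. u x - uh x) = E \<Omega>"
    using L2_norm_weak_grad_diff[of u a b uh] u uh
    by (simp add: energy_norm_def E_def D_def[abs_def] G_def H_def e_def[abs_def] \<Omega>_def)
  have E0: "0 \<le> E K" for K by (simp add: E_def)
  have "L2_inner \<Omega> G G + L2_inner \<Omega> (\<lambda>x. (\<kappa> x)\<^sup>2 * u x) u = L2_inner \<Omega> f u"
    "L2_inner \<Omega> G H + L2_inner \<Omega> (\<lambda>x. (\<kappa> x)\<^sup>2 * u x) uh = L2_inner \<Omega> f uh"
    using sol u uh' by (auto simp: weak_solution_def G_def H_def \<Omega>_def)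
  then have weak: "L2_inner \<Omega> G D + L2_inner \<Omega> (\<lambda>x. (\<kappa> x)\<^sup>2 * u x) e = L2_inner \<Omega> f e"
    unfolding D_def[abs_def] e_def[abs_def]
    by (simp add: L2_inner_diff_right G2 H2 U(1) UH(1) f2 k2)
  have green: "L2_inner \<Omega> \<tau> D = - L2_inner \<Omega> q e"
    using Hdiv_green(1)[OF \<tau>, of u] Hdiv_green(1)[OF \<tau> uh] u
    unfolding D_def[abs_def] e_def[abs_def]
    by (simp add: L2_inner_diff_right G2 H2 U(1) UH(1) \<tau>2 q2) (simp add: G_def H_def q_def \<Omega>_def)
  have "(E \<Omega>)\<^sup>2 = L2_inner \<Omega> D D + L2_inner \<Omega> (\<lambda>x. \<kappa> x * e x) (\<lambda>x. \<kappa> x * e x)"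
    by (simp add: E_def L2_norm_square L2_inner_self_nonneg)
  also have "L2_inner \<Omega> (\<lambda>x. \<kappa> x * e x) (\<lambda>x. \<kappa> x * e x) = L2_inner \<Omega> (\<lambda>x. (\<kappa> x)\<^sup>2 * u x - (\<kappa> x)\<^sup>2 * uh x) e"
    by (simp add: L2_inner_def e_def power2_eq_square algebra_simps)
  also have "L2_inner \<Omega> D D = L2_inner \<Omega> G D - L2_inner \<Omega> H D"
    unfolding D_def[abs_def] using G2 H2 by (intro L2_inner_diff_left L2_space_diff)
  also have "L2_inner \<Omega> (\<lambda>x. (\<kappa> x)\<^sup>2 * u x - (\<kappa> x)\<^sup>2 * uh x) e
      = L2_inner \<Omega> (\<lambda>x. (\<kappa> x)\<^sup>2 * u x) e - L2_inner \<Omega> (\<lambda>x. (\<kappa> x)\<^sup>2 * uh x) e"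
    by (intro L2_inner_diff_left k2 U UH e2)
  also have "L2_inner \<Omega> G D - L2_inner \<Omega> H D + \<dots> = L2_inner \<Omega> r e - L2_inner \<Omega> H D"
    unfolding r_def residual_def[abs_def] L2_inner_diff_left[OF f2 k2[OF UH(1)] e2] using weak by simp
  \<comment> \<open>Green's formula says that (\<tau>, D) + (q, e) = 0; this zero is added, which
    brings in the free flux \<tau>.\<close>
  also have "\<dots> = L2_inner \<Omega> \<sigma> D + (L2_inner \<Omega> r e + L2_inner \<Omega> q e)"
    unfolding \<sigma>_def[abs_def] L2_inner_diff_left[OF \<tau>2 H2 D2] green by simp
  also have "\<dots> = L2_inner \<Omega> \<sigma> D + L2_inner \<Omega> (\<lambda>x. r x + q x) e"
    by (simp add: L2_inner_add_left r2 q2 e2)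
  also have "\<dots> = (\<Sum>K\<in>T. L2_inner K \<sigma> D + L2_inner K (\<lambda>x. r x + q x) e)"
    using L2_inner_division[OF T \<sigma>2[unfolded \<Omega>_def] D2[unfolded \<Omega>_def]]
      L2_inner_division[OF T L2_space_add[OF r2 q2, unfolded \<Omega>_def] e2[unfolded \<Omega>_def]]
    by (simp add: sum.distrib \<Omega>_def)
  finally have identity: "(E \<Omega>)\<^sup>2 = (\<Sum>K\<in>T. L2_inner K \<sigma> D + L2_inner K (\<lambda>x. r x + q x) e)" .

  define N where "N K = div_residual_norm \<Omega> \<kappa> \<kappa>\<^sub>0 r \<tau> K" for K
  define \<theta> where "\<theta> K = eta_elem \<Omega> \<kappa> \<kappa>\<^sub>0 f uh \<tau> K" for K
  have N0: "0 \<le> N K" for K by (simp add: N_def div_residual_norm_def L2_norm_nonneg)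
  have element: "L2_inner K \<sigma> D + L2_inner K (\<lambda>x. r x + q x) e
      \<le> (\<theta> K + osc \<kappa> r K) * E K + \<kappa>\<^sub>0 * (N K * L2_norm K e)" if K: "K \<in> T" for K
  proof -
    obtain c d where Kcd: "K = cbox c d" and cd: "\<And>j. j \<in> Basis \<Longrightarrow> c \<bullet> j < d \<bullet> j"
      using elem[OF K] by blast
    have sub: "K \<subseteq> cbox a b" by (rule division_ofD(2)[OF T K])
    have KL: "K \<in> sets lebesgue" by (simp add: Kcd)
    have L: "g \<in> L2_space K" if "g \<in> L2_space \<Omega>" for g :: "'a \<Rightarrow> 'b::euclidean_space"
      using L2_space_open_box[OF _ sub KL] that by (simp add: \<Omega>_def)
    note DK = L[OF D2] and \<sigma>K = L[OF \<sigma>2] and eK = L[OF e2] and rK = L[OF r2] and qK = L[OF q2] and keK = L[OF ke2]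
    define p where "p = proj_Q1 K r"
    have pK: "p \<in> L2_space K" unfolding p_def Kcd by (rule proj_Q1(1)) (use rK Kcd in simp)
    define z where "z x = inverse (\<kappa> x + \<kappa>\<^sub>0) * (p x + q x)" for x
    have mK: "AE x in lebesgue_on K. m \<le> \<kappa> x + \<kappa>\<^sub>0" by (rule AE_open_box[OF m(2) sub KL])
    have zK: "z \<in> L2_space K" unfolding z_def[abs_def]
    proof (rule L2_space_mult_bounded[OF L2_space_add[OF pK qK]])
      have "\<kappa> \<in> borel_measurable (lebesgue_on K)"
        using borel_measurable_open_box[OF _ sub KL] \<kappa>m by (simp add: \<Omega>_def)
      then show "(\<lambda>x. inverse (\<kappa> x + \<kappa>\<^sub>0)) \<in> borel_measurable (lebesgue_on K)" by measurable
      show "AE x in lebesgue_on K. \<bar>inverse (\<kappa> x + \<kappa>\<^sub>0)\<bar> \<le> inverse m"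
        using mK by eventually_elim (use m(1) in \<open>auto intro: le_imp_inverse_le\<close>)
    qed
    have Nz: "N K = L2_norm K z"
      by (simp add: N_def div_residual_norm_def z_def[abs_def] p_def q_def)
    have \<theta>: "\<theta> K = sqrt ((L2_norm K \<sigma>)\<^sup>2 + (N K)\<^sup>2)"
      by (simp add: \<theta>_def eta_elem_def \<sigma>_def[abs_def] H_def N_def r_def)
    have k0e: "(\<lambda>x. \<kappa>\<^sub>0 * e x) \<in> L2_space K" by (rule L2_space_cmult[OF eK])
    \<comment> \<open>The weight cancels only where it is nonzero, as \<open>inverse 0 = 0\<close>;
      the lower bound \<open>m\<close> guarantees this almost everywhere.\<close>
    have "AE x in lebesgue_on K. (p x + q x) \<bullet> e x = z x \<bullet> (\<kappa> x * e x + \<kappa>\<^sub>0 * e x)"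
      using mK
    proof eventually_elim
      case (elim x)
      then have "\<kappa> x + \<kappa>\<^sub>0 \<noteq> 0" using m(1) by linarith
      then have "(p x + q x) * e x = z x * ((\<kappa> x + \<kappa>\<^sub>0) * e x)" by (simp add: z_def)
      then show ?case by (simp add: distrib_right)
    qed
    then have "L2_inner K (\<lambda>x. p x + q x) e = L2_inner K z (\<lambda>x. \<kappa> x * e x + \<kappa>\<^sub>0 * e x)"
      by (rule L2_inner_AE_cong) (intro L2_space_add pK qK eK zK keK k0e)+
    also have "\<dots> = L2_inner K z (\<lambda>x. \<kappa> x * e x) + \<kappa>\<^sub>0 * L2_inner K z e"
      using L2_inner_add_right[OF keK k0e zK] L2_inner_scaleR_right[of K z \<kappa>\<^sub>0 e] by simp
    also have "\<dots> \<le> N K * L2_norm K (\<lambda>x. \<kappa> x * e x) + \<kappa>\<^sub>0 * (N K * L2_norm K e)"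
      using L2_Cauchy_Schwarz[OF zK keK] L2_Cauchy_Schwarz[OF zK eK] k0
      by (intro add_mono mult_left_mono) (auto simp: Nz)
    finally have 1: "L2_inner K (\<lambda>x. p x + q x) e \<le> N K * L2_norm K (\<lambda>x. \<kappa> x * e x) + \<kappa>\<^sub>0 * (N K * L2_norm K e)" .
    have 2: "L2_inner K (\<lambda>x. r x - p x) e \<le> osc \<kappa> r K * E K"
      using L2_inner_osc_le[OF T K[unfolded Kcd] cd rK[unfolded Kcd] u[unfolded \<Omega>_def] uh keK[unfolded Kcd e_def]]
      by (simp add: Kcd p_def E_def D_def[abs_def] G_def H_def e_def[abs_def] \<Omega>_def)
    \<comment> \<open>Cauchy-Schwarz in the plane: flux error and weighted residual form one vector,
      the two parts of the local energy the other. Hence both enter \<open>eta_elem\<close> under a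
      single square root.\<close>
    have 3: "L2_inner K \<sigma> D + N K * L2_norm K (\<lambda>x. \<kappa> x * e x) \<le> \<theta> K * E K"
      using L2_Cauchy_Schwarz[OF \<sigma>K DK] mult_add_mult_le_sqrt[of "L2_norm K \<sigma>" "L2_norm K D" "N K" "L2_norm K (\<lambda>x. \<kappa> x * e x)"]
      unfolding \<theta> E_def by linarith
    have "L2_inner K (\<lambda>x. r x + q x) e = L2_inner K (\<lambda>x. p x + q x) e + L2_inner K (\<lambda>x. r x - p x) e"
      by (simp add: L2_inner_add_left L2_inner_diff_left rK pK qK eK)
    then show ?thesis using 1 2 3 by (simp add: distrib_right)
  qed
  define S where "S = sqrt (\<Sum>K\<in>T. (N K)\<^sup>2)"
  have S0: "0 \<le> S" by (simp add: S_def sum_nonneg)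
  define Y where "Y = eta \<Omega> T \<kappa> \<kappa>\<^sub>0 f uh \<tau>"
  have Y0: "0 \<le> Y" by (simp add: Y_def eta_def sum_nonneg)
  have EK: "sqrt (\<Sum>K\<in>T. (E K)\<^sup>2) = E \<Omega>"
    using L2_norm_division[OF T D2[unfolded \<Omega>_def]] L2_norm_division[OF T ke2[unfolded \<Omega>_def]]
    by (simp add: E_def sum.distrib \<Omega>_def)
  have eK: "sqrt (\<Sum>K\<in>T. (L2_norm K e)\<^sup>2) = L2_norm \<Omega> e"
    using L2_norm_division[OF T e2[unfolded \<Omega>_def]] by (metis L2_norm_nonneg \<Omega>_def real_sqrt_unique)
  have C0: "0 \<le> C_P a b" using C_P_pos[of a b] ab by force
  \<comment> \<open>The Friedrichs inequality is used on the whole domain, after summation over the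
    elements, because the error need not vanish on interior element boundaries.\<close>
  have "L2_norm \<Omega> e \<le> C_P a b * L2_norm \<Omega> D"
    using H10_friedrichs[OF ab, of u uh] u uh by (simp add: D_def[abs_def] G_def H_def e_def[abs_def] \<Omega>_def)
  also have "\<dots> \<le> C_P a b * E \<Omega>"
    by (intro mult_left_mono C0) (simp add: E_def real_le_rsqrt)
  finally have fr: "L2_norm \<Omega> e \<le> C_P a b * E \<Omega>" .
  have "(E \<Omega>)\<^sup>2 \<le> (\<Sum>K\<in>T. (\<theta> K + osc \<kappa> r K) * E K + \<kappa>\<^sub>0 * (N K * L2_norm K e))"
    unfolding identity by (rule sum_mono[OF element])
  also have "\<dots> = (\<Sum>K\<in>T. (\<theta> K + osc \<kappa> r K) * E K) + \<kappa>\<^sub>0 * (\<Sum>K\<in>T. N K * L2_norm K e)"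
    by (simp add: sum.distrib sum_distrib_left)
  also have "\<dots> \<le> Y * E \<Omega> + \<kappa>\<^sub>0 * (S * L2_norm \<Omega> e)"
    using sum_mult_le_sqrt[of "\<lambda>K. \<theta> K + osc \<kappa> r K" E T] sum_mult_le_sqrt[of N "\<lambda>K. L2_norm K e" T] k0
    by (intro add_mono mult_left_mono) (auto simp: EK eK S_def Y_def eta_def \<theta>_def r_def)
  also have "\<dots> \<le> Y * E \<Omega> + \<kappa>\<^sub>0 * (S * (C_P a b * E \<Omega>))"
    by (intro add_left_mono mult_left_mono fr S0 k0)
  finally have "E \<Omega> * E \<Omega> \<le> (Y + \<kappa>\<^sub>0 * C_P a b * S) * E \<Omega>"
    by (simp add: power2_eq_square algebra_simps)
  \<comment> \<open>One factor \<open>E \<Omega>\<close> is cancelled; if it is zero, the claim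
    holds since the right-hand side is nonnegative.\<close>
  then have "E \<Omega> \<le> Y + \<kappa>\<^sub>0 * C_P a b * S"
    using E0[of \<Omega>] Y0 k0 C0 S0 by (cases "E \<Omega> = 0") auto
  then show ?thesis using energy by (simp add: Y_def S_def N_def r_def \<Omega>_def)
qed

theorem theorem2p1:
  fixes a b :: "'a::euclidean_space"
    and \<Omega> :: "'a set" and T :: "'a set set"
    and \<kappa> f u uh :: "'a \<Rightarrow> real" and \<tau> :: "'a \<Rightarrow> 'a"
  assumes "\<forall>i\<in>Basis. a \<bullet> i < b \<bullet> i"
    and "\<Omega> = box a b"
    and "hyperrectangular_mesh T \<Omega>"
    and "\<kappa> \<in> Linf_space \<Omega>"
    and "AE x in lebesgue_on \<Omega>. 0 \<le> \<kappa> x"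
    and "f \<in> L2_space \<Omega>"
    and "weak_solution \<Omega> \<kappa> f u"
    and "uh \<in> H10_space \<Omega>"
    and "\<tau> \<in> Hdiv_space \<Omega>"
  shows "(\<forall>\<kappa>\<^sub>0>0. energy_norm \<Omega> \<kappa> (\<lambda>x. u x - uh x)
             \<le> eta \<Omega> T \<kappa> \<kappa>\<^sub>0 f uh \<tau>
               + \<kappa>\<^sub>0 * C_P a b * sqrt (\<Sum>K\<in>T. (div_residual_norm \<Omega> \<kappa> \<kappa>\<^sub>0 (residual \<kappa> f uh) \<tau> K)\<^sup>2))
       \<and> (0 < ess_inf \<Omega> \<kappa> \<longrightarrow>
            energy_norm \<Omega> \<kappa> (\<lambda>x. u x - uh x) \<le> eta \<Omega> T \<kappa> 0 f uh \<tau>)"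
proof (intro conjI allI impI)
  have ab: "a \<bullet> j < b \<bullet> j" if "j \<in> Basis" for j using assms(1) that by blast
  have estimate: "energy_norm \<Omega> \<kappa> (\<lambda>x. u x - uh x) \<le> eta \<Omega> T \<kappa> \<kappa>\<^sub>0 f uh \<tau>
      + \<kappa>\<^sub>0 * C_P a b * sqrt (\<Sum>K\<in>T. (div_residual_norm \<Omega> \<kappa> \<kappa>\<^sub>0 (residual \<kappa> f uh) \<tau> K)\<^sup>2)"
    if "0 \<le> \<kappa>\<^sub>0" "0 < m" "AE x in lebesgue_on \<Omega>. m \<le> \<kappa> x + \<kappa>\<^sub>0" for \<kappa>\<^sub>0 m
    using energy_error_estimate[OF ab assms(3,4,6,7,8,9)[unfolded assms(2)]] that unfolding assms(2) by blast
  \<comment> \<open>Since \<kappa> is nonnegative almost everywhere, \<open>\<kappa>\<^sub>0\<close>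
    itself serves as the lower bound of \<open>\<kappa> + \<kappa>\<^sub>0\<close>.\<close>
  show "energy_norm \<Omega> \<kappa> (\<lambda>x. u x - uh x) \<le> eta \<Omega> T \<kappa> \<kappa>\<^sub>0 f uh \<tau>
      + \<kappa>\<^sub>0 * C_P a b * sqrt (\<Sum>K\<in>T. (div_residual_norm \<Omega> \<kappa> \<kappa>\<^sub>0 (residual \<kappa> f uh) \<tau> K)\<^sup>2)"
    if "0 < \<kappa>\<^sub>0" for \<kappa>\<^sub>0
    using that assms(5) by (intro estimate[of \<kappa>\<^sub>0 \<kappa>\<^sub>0]) auto
  assume "0 < ess_inf \<Omega> \<kappa>"
  then obtain m where "0 < m" "AE x in lebesgue_on \<Omega>. m \<le> \<kappa> x"
    by (rule ess_inf_pos)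
  then show "energy_norm \<Omega> \<kappa> (\<lambda>x. u x - uh x) \<le> eta \<Omega> T \<kappa> 0 f uh \<tau>"
    using estimate[of 0 m] by simp
qed

end
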